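(* Let $d,\ell\in\mathbb{N}^+$ and $\sigma>0$, and assume $F_1,\dots,F_\ell\in\mathcal{G}(\mathbb{T}_\sigma^d)$. Then for almost all $(\rho_1,\dots,\rho_\ell)\in(\mathbb{T}^d)^\ell$ (with respect to Lebesgue measure) there is some $\zeta_1>0$ such that, for $N\in\mathbb N^+$ and $T>0$ sufficiently large, $$\Big|\mathrm{DMW}_N^\ell(\mathcal F)(\theta)-\prod_{j=1}^\ell\Big(\int_{\mathbb{T}^d}F_j(\hat\theta)\,d\hat\theta\Big)\Big|=\mathcal{O}\big(\exp(-N^{\zeta_1})\big)$$ and $$\Big|\mathrm{CMW}_T^\ell(\mathcal F)(\theta)-\prod_{j=1}^\ell\Big(\int_{\mathbb{T}^d}F_j(\hat\theta)\,d\hat\theta\Big)\Big|=\mathcal{O}\big(\exp(-T^{\zeta_1})\big).$$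
   Context: Weight: $w(x)=\exp(-x^{-1}(1-x)^{-1})\big(\int_0^1\exp(-t^{-1}(1-t)^{-1})dt\big)^{-1}$ for $x\in(0,1)$ and $w(x)=0$ otherwise. Torus and rotations: $\mathbb{T}^d=[0,1]^d$ with coordinates mod 1; for $\rho\in\mathbb{T}^d$ and $s\ge0$, $\mathscr{T}_\rho^s(\theta)=\theta+s\rho \bmod 1$ in each coordinate. Averages (for $\theta\in\mathbb{T}^d$): with $A_N=\sum_{s=0}^{N-1}w(s/N)$, $$\mathrm{DMW}_N^\ell(\mathcal F)(\theta)=\frac1{A_N}\sum_{n=0}^{N-1}w(n/N)F_1(\mathscr{T}_{\rho_1}^n(\theta))\cdots F_\ell(\mathscr{T}_{\rho_\ell}^n(\theta)),$$ $$\mathrm{CMW}_T^\ell(\mathcal F)(\theta)=\frac1T\int_0^T w(s/T)F_1(\mathscr{T}_{\rho_1}^s(\theta))\cdots F_\ell(\mathscr{T}_{\rho_\ell}^s(\theta))\,ds .$$ Analytic functions: $\|k\|$ is the $1$-norm of $k\in\mathbb{Z}^d$; $\mathbb{T}_\sigma^d=\{\theta=(\theta_j)_{1\le j\le d},\ \theta_j\in\mathbb{C}:\operatorname{Re}\theta_j\in\mathbb{T},\ |\operatorname{Im}\theta_j|\le\sigma\}$, and $\mathcal{G}(\mathbb{T}_\sigma^d)$ is the Banach space of functions $u(\theta)=\sum_{k\in\mathbb{Z}^d}\hat u_ke^{2\pi i k\cdot\theta}$ (scalar coefficients) with $\sum_{k\in\mathbb{Z}^d}|\hat u_k|e^{2\pi\sigma\|k\|}<+\infty$.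 $\mathcal{O}(\cdot)$ means bounded by a constant, independent of $N$ (resp. $T$), times the argument for all sufficiently large $N$ (resp. $T$). *)

theory Defs
  imports "HOL-Analysis.Analysis"
begin

definition weight :: "real \<Rightarrow> real" where
  "weight x =
     (if 0 < x \<and> x < 1
      then exp (- (inverse x * inverse (1 - x))) /
           (LINT t:{0<..<1}|lborel. exp (- (inverse t * inverse (1 - t))))
      else 0)"

(* The torus is represented by the cube; coordinates are read modulo 1 through frac in rotation. *)
definition torus :: "(real ^ 'd) set" where
  "torus = {\<theta>. \<forall>i. 0 \<le> \<theta> $ i \<and> \<theta> $ i \<le> 1}"

definition torus_power :: "(real ^ 'd ^ 'l) set" where
  "torus_power = {\<rho>. \<forall>j. \<rho> $ j \<in> torus}"

definition rotation :: "real ^ 'd \<Rightarrow> real \<Rightarrow> real ^ 'd \<Rightarrow> real ^ 'd" where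
  "rotation \<rho> s \<theta> = (\<chi> i. frac (\<theta> $ i + s * \<rho> $ i))"

definition DMW ::
  "('l::finite \<Rightarrow> real ^ 'd \<Rightarrow> complex) \<Rightarrow> real ^ 'd ^ 'l \<Rightarrow> nat \<Rightarrow> real ^ 'd \<Rightarrow> complex" where
  "DMW F \<rho> N \<theta> =
     (1 / complex_of_real (\<Sum>s<N. weight (real s / real N))) *
     (\<Sum>n<N. complex_of_real (weight (real n / real N)) *
             (\<Prod>j\<in>UNIV. F j (rotation (\<rho> $ j) (real n) \<theta>)))"

definition CMW ::
  "('l::finite \<Rightarrow> real ^ 'd \<Rightarrow> complex) \<Rightarrow> real ^ 'd ^ 'l \<Rightarrow> real \<Rightarrow> real ^ 'd \<Rightarrow> complex" where
  "CMW F \<rho> T \<theta> =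
     (1 / complex_of_real T) *
     (LINT s:{0..T}|lborel. complex_of_real (weight (s / T)) *
             (\<Prod>j\<in>UNIV. F j (rotation (\<rho> $ j) s \<theta>)))"

definition torus_integral :: "(real ^ 'd \<Rightarrow> complex) \<Rightarrow> complex" where
  "torus_integral f = (LINT \<theta>:torus|lborel. f \<theta>)"

definition norm1 :: "int ^ 'd \<Rightarrow> int" where
  "norm1 k = (\<Sum>i\<in>UNIV. \<bar>k $ i\<bar>)"

definition strip :: "real \<Rightarrow> (complex ^ 'd) set" where
  "strip \<sigma> = {\<theta>. \<forall>i. 0 \<le> Re (\<theta> $ i) \<and> Re (\<theta> $ i) \<le> 1 \<and> \<bar>Im (\<theta> $ i)\<bar> \<le> \<sigma>}"

definition character :: "int ^ 'd \<Rightarrow> complex ^ 'd \<Rightarrow> complex" where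
  "character k \<theta> = exp (2 * of_real pi * \<i> * (\<Sum>i\<in>UNIV. of_int (k $ i) * \<theta> $ i))"

(* Only the values of u on the strip are constrained. *)
definition analytic_space :: "real \<Rightarrow> (complex ^ 'd \<Rightarrow> complex) set" where
  "analytic_space \<sigma> =
     {u. \<exists>c :: int ^ 'd \<Rightarrow> complex.
           (\<lambda>k. norm (c k) * exp (2 * pi * \<sigma> * real_of_int (norm1 k))) summable_on UNIV \<and>
           (\<forall>\<theta>\<in>strip \<sigma>. ((\<lambda>k. c k * character k \<theta>) has_sum u \<theta>) UNIV)}"

definition on_torus :: "(complex ^ 'd \<Rightarrow> complex) \<Rightarrow> real ^ 'd \<Rightarrow> complex" where
  "on_torus u \<theta> = u (\<chi> i. complex_of_real (\<theta> $ i))"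

end

theory Submission
  imports Defs "HOL-Complex_Analysis.Residue_Theorem" "HOL-Real_Asymp.Real_Asymp"
begin

text \<open>
  Expanding the product of the \<open>F j\<close> along the rotated orbit gives an absolutely convergent series of
  plane waves \<open>s \<mapsto> exp (2 \<pi> i s \<phi>)\<close>, indexed by \<ell>-tuples \<open>K\<close> of frequencies, with \<open>\<phi> = K \<cdot> \<rho>\<close>
  (\<open>rotated_product_has_sum\<close>). The wave with \<open>K = 0\<close> is constant and its coefficient is the product of
  the integrals (\<open>torus_integral_eq_coefficient\<close>). Averaging is linear, so the error is the sum over
  \<open>K \<noteq> 0\<close> of coefficient times average of a single wave, and two facts make it small.

  Up to normalisation, the weight is the restriction to the real axis of \<open>exp (- 1/z - 1/(1 - z))\<close>, which is holomorphic and
  bounded by 1 on the whole vertical strip \<open>0 < Re z < 1\<close>, because \<open>Re (1/z) > 0\<close> there. Rescaled to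
  \<open>[0, x]\<close>, the average of one wave can therefore be moved to a rectangle of height \<open>h\<close>: the horizontal
  sides gain \<open>exp (- 2 \<pi> \<kappa> h)\<close> from the wave, where \<open>\<kappa>\<close> bounds below the distance from \<open>\<phi>\<close> to the
  integers, and the vertical sides, placed half a unit inside the strip, gain \<open>exp (- x / (4 h\<^sup>2))\<close>
  from the weight. For the integral the rectangle is governed by Cauchy's theorem
  (\<open>bump_exponential_integral_bound\<close>); for the sum it is governed by the residue theorem applied to
  the wave divided by \<open>exp (2 \<pi> i z) - 1\<close>, whose poles are the integers
  (\<open>bump_exponential_sum_bound\<close>). The choice \<open>h = x powr (1/3)\<close> makes both gains stretched
  exponential as long as \<open>\<kappa>\<close> is not much smaller than \<open>x powr (- 1/6)\<close>.

  For almost every \<open>\<rho>\<close> the distance from \<open>K \<cdot> \<rho>\<close> to the integers is at least a constant over a power of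
  the size of \<open>K\<close> (\<open>AE_diophantine\<close>). Hence the waves with \<open>K\<close> up to a small power of \<open>x\<close> decay as
  above, while all larger \<open>K\<close> are damped by the exponential decay of the coefficients of
  analytic functions (\<open>small_divisor_bound\<close>). Both contributions are below \<open>exp (- x powr \<zeta>)\<close>
  for a suitable \<open>\<zeta>\<close>.
\<close>

section \<open>The weight in the complex plane\<close>

definition bump :: "real \<Rightarrow> real" where
  "bump x = (if 0 < x \<and> x < 1 then exp (- (inverse x * inverse (1 - x))) else 0)"

lemma bump_nonneg: "0 \<le> bump x"
  by (simp add: bump_def)

lemma bump_le_one: "bump x \<le> 1"
  by (simp add: bump_def)

text \<open>The holomorphic extension of \<open>s \<mapsto> bump (s / T)\<close>. The exponent uses the partial fractions
  \<open>1 / (x (1 - x)) = 1/x + 1/(1 - x)\<close>, whose two terms separately have positive real part on the strip.\<close>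

definition bump_ext :: "real \<Rightarrow> complex \<Rightarrow> complex" where
  "bump_ext T z = exp (- (of_real T / z + of_real T / (of_real T - z)))"

lemma bump_ext_of_real:
  assumes "0 < s" "s < T"
  shows "bump_ext T (of_real s) = of_real (bump (s / T))"
proof -
  have "inverse (s / T) * inverse (1 - s / T) = T / s + T / (T - s)"
    using assms by (simp add: field_simps)
  moreover have "s / T < 1" "0 < s / T" using assms by auto
  ultimately show ?thesis
    by (simp add: bump_ext_def bump_def flip: exp_of_real)
qed

lemma Re_of_real_divide_nonneg:
  assumes "0 < Re z" "0 \<le> T"
  shows "Re (of_real T / z) \<ge> 0"
  using assms by (simp add: Re_divide)

lemma norm_bump_ext_le:
  assumes "0 < Re z" "Re z < T"
  shows "norm (bump_ext T z) \<le> 1"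
    and "norm (bump_ext T z) \<le> exp (- Re (of_real T / z))"
    and "norm (bump_ext T z) \<le> exp (- Re (of_real T / (of_real T - z)))"
  using Re_of_real_divide_nonneg[of z T] Re_of_real_divide_nonneg[of "of_real T - z" T] assms
  by (auto simp: bump_ext_def)

text \<open>On the lines half a unit inside the strip, \<open>Re (T / z) = (T/2) / (1/4 + y\<^sup>2)\<close>, so the
  extension stays tiny up to heights well below the square root of \<open>T\<close>. Lines at distance 1/2 also pass
  halfway between consecutive integers, which the discrete sum needs.\<close>

lemma norm_bump_ext_side:
  assumes "1 < T" "1 \<le> h" "\<bar>Im z\<bar> \<le> h" "Re z = 1/2 \<or> Re z = T - 1/2"
  shows "norm (bump_ext T z) \<le> exp (- (T / (4 * h\<^sup>2)))"
proof -
  have *: "T / (4 * h\<^sup>2) \<le> Re (of_real T / w)" if "Re w = 1/2" "\<bar>Im w\<bar> \<le> h" for w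
  proof -
    have "(Im w)\<^sup>2 \<le> h\<^sup>2" using that(2) assms(2) by (intro abs_le_square_iff[THEN iffD1]) auto
    moreover have "1 \<le> h\<^sup>2" using assms by simp
    ultimately have "(1/2)\<^sup>2 + (Im w)\<^sup>2 \<le> 2 * h\<^sup>2" by (simp add: power2_eq_square)
    moreover have "Re (of_real T / w) = (T/2) / ((1/2)\<^sup>2 + (Im w)\<^sup>2)"
      unfolding Re_divide that(1) by simp
    moreover have "T / (4 * h\<^sup>2) = (T/2) / (2 * h\<^sup>2)" by simp
    moreover have "(1/2)\<^sup>2 + (Im w)\<^sup>2 > 0" by (simp add: add_pos_nonneg)
    ultimately show ?thesis using assms(1)
      by (auto intro!: divide_left_mono mult_pos_pos)
  qed
  from assms(4) show ?thesis
  proof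
    assume "Re z = 1/2"
    then show ?thesis
      using norm_bump_ext_le(2)[of z T] *[of z] assms by (auto elim!: order_trans)
  next
    assume "Re z = T - 1/2"
    then show ?thesis
      using norm_bump_ext_le(3)[of z T] *[of "of_real T - z"] assms by (auto elim!: order_trans)
  qed
qed

lemma holomorphic_bump_ext: "bump_ext T holomorphic_on {z. 0 < Re z \<and> Re z < T}"
  unfolding bump_ext_def by (intro holomorphic_intros) auto

lemma open_convex_vertical_strip:
  "open {z. 0 < Re z \<and> Re z < T}" "convex {z. 0 < Re z \<and> Re z < T}"
proof -
  have "{z. 0 < Re z \<and> Re z < T} = {z. 0 < Re z} \<inter> {z. Re z < T}" by auto
  then show "open {z. 0 < Re z \<and> Re z < T}" "convex {z. 0 < Re z \<and> Re z < T}"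
    by (auto intro!: open_Int convex_Int open_halfspace_Re_gt open_halfspace_Re_lt
        convex_halfspace_Re_gt convex_halfspace_Re_lt)
qed

section \<open>Decay of one wave by contour shifting\<close>

lemma contour_integral_rectpath:
  assumes "a < b" "c < d" and "continuous_on (path_image (rectpath (Complex a c) (Complex b d))) f"
  shows "contour_integral (rectpath (Complex a c) (Complex b d)) f =
     contour_integral (linepath (Complex a c) (Complex b c)) f
   + contour_integral (linepath (Complex b c) (Complex b d)) f
   + contour_integral (linepath (Complex b d) (Complex a d)) f
   + contour_integral (linepath (Complex a d) (Complex a c)) f" (is ?eq)
  and "f contour_integrable_on linepath (Complex a c) (Complex b c)" (is ?i1)
  and "f contour_integrable_on linepath (Complex b c) (Complex b d)" (is ?i2)
  and "f contour_integrable_on linepath (Complex b d) (Complex a d)" (is ?i3)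
  and "f contour_integrable_on linepath (Complex a d) (Complex a c)" (is ?i4)
proof -
  have im: "path_image (rectpath (Complex a c) (Complex b d)) =
     closed_segment (Complex a c) (Complex b c) \<union> closed_segment (Complex b c) (Complex b d)
     \<union> closed_segment (Complex b d) (Complex a d) \<union> closed_segment (Complex a d) (Complex a c)"
    by (simp add: rectpath_def Let_def path_image_join Un_assoc)
  note cs = continuous_on_subset[OF assms(3)]
  show i: ?i1 ?i2 ?i3 ?i4
    by (intro contour_integrable_continuous_linepath cs; auto simp: im)+
  show ?eq
    using i by (simp add: rectpath_def Let_def contour_integral_join contour_integrable_join valid_path_join add_ac)
qed

text \<open>Solves the contour identity for the bottom side: for the integral that side carries the quantity to
  be estimated, while for the sum it is one more small term.\<close>

lemma contour_integral_rectpath_sides: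
  assumes "a < b" "c < d" and cont: "continuous_on (path_image (rectpath (Complex a c) (Complex b d))) f"
    and V: "\<And>z. \<lbrakk>Re z = a \<or> Re z = b; c \<le> Im z; Im z \<le> d\<rbrakk> \<Longrightarrow> norm (f z) \<le> V"
    and H: "\<And>z. \<lbrakk>Im z = d; a \<le> Re z; Re z \<le> b\<rbrakk> \<Longrightarrow> norm (f z) \<le> H"
  shows "norm (contour_integral (rectpath (Complex a c) (Complex b d)) f
           - contour_integral (linepath (Complex a c) (Complex b c)) f)
         \<le> 2 * (d - c) * V + (b - a) * H"
proof -
  note R = contour_integral_rectpath[OF assms(1-3)]
  have V0: "0 \<le> V" using V[of "Complex a c"] assms(1,2) norm_ge_zero[of "f (Complex a c)"] by (simp del: norm_ge_zero)
  have H0: "0 \<le> H" using H[of "Complex a d"] assms(1,2) norm_ge_zero[of "f (Complex a d)"] by (simp del: norm_ge_zero)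
  have n1: "norm (contour_integral (linepath (Complex b c) (Complex b d)) f) \<le> V * norm (Complex b d - Complex b c)"
    by (rule contour_integral_bound_linepath[OF R(3) V0])
       (rule V, use assms in \<open>auto simp: closed_segment_same_Re closed_segment_eq_real_ivl\<close>)
  have n2: "norm (contour_integral (linepath (Complex b d) (Complex a d)) f) \<le> H * norm (Complex a d - Complex b d)"
    by (rule contour_integral_bound_linepath[OF R(4) H0])
       (rule H, use assms in \<open>auto simp: closed_segment_same_Im closed_segment_eq_real_ivl\<close>)
  have n3: "norm (contour_integral (linepath (Complex a d) (Complex a c)) f) \<le> V * norm (Complex a c - Complex a d)"
    by (rule contour_integral_bound_linepath[OF R(5) V0])
       (rule V, use assms in \<open>auto simp: closed_segment_same_Re closed_segment_eq_real_ivl\<close>)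
  have len: "norm (Complex b d - Complex b c) = d - c" "norm (Complex a d - Complex b d) = b - a"
     "norm (Complex a c - Complex a d) = d - c"
    using assms by (auto simp: complex_norm complex_diff)
  have three: "norm (x + y + w) \<le> 2 * (d - c) * V + (b - a) * H"
    if "norm x \<le> V * (d - c)" "norm y \<le> H * (b - a)" "norm w \<le> V * (d - c)" for x y w :: complex
  proof -
    have "norm (x + y + w) \<le> norm x + norm y + norm w"
      by (meson add_right_mono norm_triangle_ineq order_trans)
    also have "\<dots> \<le> V * (d - c) + H * (b - a) + V * (d - c)"
      by (intro add_mono that)
    also have "\<dots> = 2 * (d - c) * V + (b - a) * H"
      by (simp add: algebra_simps)
    finally show ?thesis .
  qed
  have "u + x + y + w - u = x + y + w" for u x y w :: complex
    by simp
  then show ?thesis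
    unfolding R(1) using three[OF n1[unfolded len] n2[unfolded len] n3[unfolded len]] by (simp only:)
qed

lemma norm_exp_wave: "norm (exp (2 * of_real pi * \<i> * of_real a * z)) = exp (- (2 * pi * a * Im z))"
  by simp

lemma exp_wave_of_real: "exp (2 * of_real pi * \<i> * of_real a * of_real s) = cis (2 * pi * a * s)"
  by (simp add: cis_conv_exp mult_ac)

text \<open>On vertical lines through half-integers \<open>exp (2 \<pi> i z)\<close> is negative real, hence far from the value
  1 at which the kernel has its poles.\<close>

lemma exp_wave_half:
  assumes "Re z = 1/2 \<or> Re z = real N - 1/2"
  shows "exp (2 * of_real pi * \<i> * z) = - of_real (exp (- (2 * pi * Im z)))"
proof -
  have "cis (2 * pi * Re z) = -1"
  proof -
    have "cis (2 * pi * (real N - 1/2)) = cis (2 * pi * real N) * cis (- pi)"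
      by (simp add: cis_mult algebra_simps)
    also have "cis (2 * pi * real N) = 1"
      by (metis cis_multiple_2pi Ints_of_nat)
    finally have "cis (2 * pi * (real N - 1/2)) = -1" by (simp add: complex_eq_iff)
    moreover have "cis (2 * pi * (1/2)) = -1" by (simp add: complex_eq_iff)
    ultimately show ?thesis using assms by metis
  qed
  moreover have "exp (2 * of_real pi * \<i> * z) = of_real (exp (- (2 * pi * Im z))) * cis (2 * pi * Re z)"
    by (subst (1) complex_eq[of z]) (simp add: exp_eq_polar)
  ultimately show ?thesis by simp
qed

lemma wave_kernel_vertical:
  assumes "Re z = 1/2 \<or> Re z = real N - 1/2" "0 \<le> a" "a \<le> 1"
  shows "norm (exp (2 * of_real pi * \<i> * of_real a * z)) \<le> norm (exp (2 * of_real pi * \<i> * z) - 1)"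
proof -
  have "exp (2 * of_real pi * \<i> * z) - 1 = - of_real (exp (- (2 * pi * Im z)) + 1)"
    using exp_wave_half[OF assms(1)] by simp
  then have "norm (exp (2 * of_real pi * \<i> * z) - 1) = exp (- (2 * pi * Im z)) + 1"
    by (metis abs_of_nonneg add_nonneg_nonneg exp_ge_zero norm_minus_cancel norm_of_real zero_le_one)
  moreover have "exp (- (2 * pi * a * Im z)) \<le> exp (- (2 * pi * Im z)) + 1"
  proof (cases "Im z \<ge> 0")
    case True
    then have "exp (- (2 * pi * a * Im z)) \<le> 1" using assms by simp
    then show ?thesis by (simp add: add_increasing)
  next
    case False
    then have "2 * pi * Im z \<le> 2 * pi * a * Im z"
      using assms by (simp add: mult_le_cancel_right)
    then show ?thesis by (intro add_increasing2) auto
  qed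
  ultimately show ?thesis unfolding norm_exp_wave by simp
qed

text \<open>The kernel decays in both directions: upwards like \<open>exp (- 2 \<pi> a h)\<close>, and downwards like
  \<open>exp (- 2 \<pi> (1 - a) h)\<close> because the denominator then grows like \<open>exp (2 \<pi> h)\<close>. This is why
  the distance from \<open>a\<close> to both neighbouring integers matters.\<close>

lemma wave_kernel_horizontal:
  assumes "\<bar>Im z\<bar> = h" "1 \<le> h" "\<kappa> \<le> a" "a \<le> 1 - \<kappa>"
  shows "norm (exp (2 * of_real pi * \<i> * of_real a * z) / (exp (2 * of_real pi * \<i> * z) - 1))
           \<le> 2 * exp (- (2 * pi * \<kappa> * h))"
proof -
  have n: "norm (exp (2 * of_real pi * \<i> * z)) = exp (- (2 * pi * Im z))"
    using norm_exp_wave[of 1 z] by simp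
  have "1 \<le> 2 * pi * h"
    using assms(2) pi_gt3 mult_mono[of 1 "2*pi" 1 h] by simp
  then have e2: "2 \<le> exp (2 * pi * h)"
    using exp_ge_add_one_self[of "2 * pi * h"] by linarith
  show ?thesis
  proof (cases "Im z \<ge> 0")
    case True
    then have y: "Im z = h" using assms by simp
    have "exp (- (2 * pi * h)) \<le> 1/2"
      using e2 by (simp add: exp_minus field_simps)
    then have d: "1/2 \<le> norm (exp (2 * of_real pi * \<i> * z) - 1)"
      using norm_triangle_ineq3[of "exp (2 * of_real pi * \<i> * z)" 1] n y by simp
    have "2 * pi * \<kappa> * h \<le> 2 * pi * a * h" using assms by simp
    then have "norm (exp (2 * of_real pi * \<i> * of_real a * z)) \<le> exp (- (2 * pi * \<kappa> * h))"
      unfolding norm_exp_wave y by simp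
    note e = this
    show ?thesis unfolding norm_divide
      using frac_le[OF exp_ge_zero e _ d] by simp
  next
    case False
    then have y: "Im z = - h" using assms by simp
    have d: "exp (2 * pi * h) / 2 \<le> norm (exp (2 * of_real pi * \<i> * z) - 1)"
      using norm_triangle_ineq3[of "exp (2 * of_real pi * \<i> * z)" 1] n y e2 by simp
    have "a * h + \<kappa> * h \<le> h" using mult_right_mono[of "a + \<kappa>" 1 h] assms by (simp add: algebra_simps)
    then have "2 * pi * (a * h + \<kappa> * h) \<le> 2 * pi * h" by simp
    then have "2 * pi * a * h \<le> - (2 * pi * \<kappa> * h) + 2 * pi * h"
      by (simp add: algebra_simps)
    then have "norm (exp (2 * of_real pi * \<i> * of_real a * z)) \<le> exp (- (2 * pi * \<kappa> * h)) * exp (2 * pi * h)"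
      unfolding norm_exp_wave y by (simp add: exp_add[symmetric])
    note e = this
    show ?thesis unfolding norm_divide
      using frac_le[OF _ e _ d] by simp
  qed
qed

text \<open>The residues of the wave times the extended weight over \<open>exp (2 \<pi> i z) - 1\<close> at the integers
  \<open>1, \<dots>, N - 1\<close> add up to the sum (up to \<open>2 \<pi> i\<close>), so the sum is the integral over the boundary of a
  rectangle on which every side is small.\<close>

lemma bump_exponential_sum_bound:
  fixes N :: nat
  assumes N: "2 \<le> N" and h: "1 \<le> h" and \<kappa>: "0 < \<kappa>" "\<kappa> \<le> a" "a \<le> 1 - \<kappa>"
  shows "norm (\<Sum>n\<in>{1..<N}. of_real (bump (real n / real N)) * cis (2 * pi * a * real n))
         \<le> 4 * h * exp (- (real N / (4 * h\<^sup>2))) + 4 * real N * exp (- (2 * pi * \<kappa> * h))"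
proof -
  define S where "S = {z. 0 < Re z \<and> Re z < real N}"
  define pts :: "complex set" where "pts = of_nat ` {1..<N}"
  define num where "num z = bump_ext N z * exp (2 * of_real pi * \<i> * of_real a * z)" for z
  define den where "den z = exp (2 * of_real pi * \<i> * z) - 1" for z :: complex
  define p q where "p = Complex (1/2) (-h)" and "q = Complex (real N - 1/2) h"
  have S: "open S" "convex S" unfolding S_def by (rule open_convex_vertical_strip)+
  have pq: "Re p < Re q" "Im p < Im q" using N h by (auto simp: p_def q_def)
  have num_holo: "num holomorphic_on S"
    unfolding num_def S_def by (intro holomorphic_intros holomorphic_bump_ext)
  have den_holo: "den holomorphic_on A" for A
    unfolding den_def by (intro holomorphic_intros)
  have den_zero: "z \<in> pts" if z: "z \<in> S" "den z = 0" for z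
  proof -
    obtain n :: int where n: "Re (2 * of_real pi * \<i> * z) = 0" "Im (2 * of_real pi * \<i> * z) = of_int (2 * n) * pi"
      using z(2) unfolding den_def by (auto simp: exp_eq_1)
    then have zn: "z = of_int n" by (auto simp: complex_eq_iff)
    with z(1) have "0 < n" "n < int N" by (auto simp: S_def)
    then have "z = of_nat (nat n)" "nat n \<in> {1..<N}" using zn by auto
    then show ?thesis unfolding pts_def by blast
  qed
  have holo: "(\<lambda>z. num z / den z) holomorphic_on S - pts"
    using den_zero by (intro holomorphic_on_divide den_holo holomorphic_on_subset[OF num_holo]) auto
  have img: "path_image (rectpath p q) \<subseteq> S - pts"
  proof -
    have "z \<notin> pts" if "z \<in> path_image (rectpath p q)" for z
    proof
      assume "z \<in> pts"
      then obtain n where n: "z = of_nat n" "1 \<le> n" "n < N" by (auto simp: pts_def)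
      then have "z \<in> box p q" using N h by (auto simp: p_def q_def in_box_complex_iff)
      then show False using that pq path_image_rectpath_inter_box[of p q] by auto
    qed
    moreover have "path_image (rectpath p q) \<subseteq> S"
      using path_image_rectpath_subset_cbox[of p q] pq N
      by (force simp: p_def q_def in_cbox_complex_iff S_def)
    ultimately show ?thesis by auto
  qed
  have res: "residue (\<lambda>z. num z / den z) (of_nat n) = num (of_nat n) / (2 * of_real pi * \<i>)"
    if "n \<in> {1..<N}" for n
  proof (rule residue_simple_pole_deriv[where s = S])
    have e: "exp (2 * of_real pi * \<i> * of_nat n) = 1"
      by (metis exp_of_nat2_mult exp_two_pi_i power_one mult.commute mult.left_commute)
    show "(den has_field_derivative 2 * of_real pi * \<i>) (at (of_nat n))"
      unfolding den_def by (auto intro!: derivative_eq_intros simp: e)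
    show "den (of_nat n) = 0" by (simp add: den_def e)
    show "num (of_nat n) \<noteq> 0" by (simp add: num_def bump_ext_def)
    show "of_nat n \<in> S" using that by (simp add: S_def)
    show "connected S" by (rule convex_connected[OF S(2)])
  qed (use S num_holo den_holo in auto)
  have "contour_integral (rectpath p q) (\<lambda>z. num z / den z)
      = 2 * pi * \<i> * (\<Sum>w\<in>pts. winding_number (rectpath p q) w * residue (\<lambda>z. num z / den z) w)"
  proof (rule Residue_theorem[OF S(1) convex_connected[OF S(2)] _ holo _ _ img])
    show "\<forall>z. z \<notin> S \<longrightarrow> winding_number (rectpath p q) z = 0"
    proof (intro allI impI)
      fix z assume "z \<notin> S"
      then have "z \<notin> cbox p q" using N by (auto simp: p_def q_def in_cbox_complex_iff S_def)
      then show "winding_number (rectpath p q) z = 0" using pq by (intro winding_number_rectpath_outside) auto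
    qed
  qed (auto simp: pts_def)
  also have "(\<Sum>w\<in>pts. winding_number (rectpath p q) w * residue (\<lambda>z. num z / den z) w)
      = (\<Sum>n\<in>{1..<N}. winding_number (rectpath p q) (of_nat n) * residue (\<lambda>z. num z / den z) (of_nat n))"
    unfolding pts_def by (subst sum.reindex) (auto simp: inj_on_def)
  also have "\<dots> = (\<Sum>n\<in>{1..<N}. num (of_nat n) / (2 * of_real pi * \<i>))"
  proof (rule sum.cong[OF refl])
    fix n assume n: "n \<in> {1..<N}"
    then have "of_nat n \<in> box p q" using h by (auto simp: p_def q_def in_box_complex_iff)
    then show "winding_number (rectpath p q) (of_nat n) * residue (\<lambda>z. num z / den z) (of_nat n)
        = num (of_nat n) / (2 * of_real pi * \<i>)"
      using res[OF n] winding_number_rectpath by simp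
  qed
  also have "2 * pi * \<i> * \<dots> = (\<Sum>n\<in>{1..<N}. num (of_nat n))"
    by (simp add: sum_divide_distrib[symmetric])
  also have "\<dots> = (\<Sum>n\<in>{1..<N}. of_real (bump (real n / real N)) * cis (2 * pi * a * real n))"
  proof (rule sum.cong[OF refl])
    fix n assume "n \<in> {1..<N}"
    then show "num (of_nat n) = of_real (bump (real n / real N)) * cis (2 * pi * a * real n)"
      using bump_ext_of_real[of "real n" "real N"] exp_wave_of_real[of a "real n"] by (simp add: num_def)
  qed
  finally have eq: "contour_integral (rectpath p q) (\<lambda>z. num z / den z)
     = (\<Sum>n\<in>{1..<N}. of_real (bump (real n / real N)) * cis (2 * pi * a * real n))" .
  define H where "H = 2 * exp (- (2 * pi * \<kappa> * h))"
  have bH: "norm (num z / den z) \<le> H" if "\<bar>Im z\<bar> = h" "1/2 \<le> Re z" "Re z \<le> real N - 1/2" for z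
  proof -
    have "norm (num z / den z) = norm (bump_ext N z) * norm (exp (2 * of_real pi * \<i> * of_real a * z) / den z)"
      unfolding num_def by (simp add: norm_mult norm_divide)
    also have "\<dots> \<le> 1 * H"
      unfolding H_def den_def using that h \<kappa>
      by (intro mult_mono norm_bump_ext_le wave_kernel_horizontal) auto
    finally show ?thesis by simp
  qed
  have bV: "norm (num z / den z) \<le> exp (- (real N / (4 * h\<^sup>2)))"
    if "Re z = 1/2 \<or> Re z = real N - 1/2" "- h \<le> Im z" "Im z \<le> h" for z
  proof -
    have "norm (num z / den z) = norm (bump_ext N z) * (norm (exp (2 * of_real pi * \<i> * of_real a * z)) / norm (den z))"
      unfolding num_def by (simp add: norm_mult norm_divide)
    also have "\<dots> \<le> exp (- (real N / (4 * h\<^sup>2))) * 1"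
    proof (intro mult_mono norm_bump_ext_side)
      show "norm (exp (2 * of_real pi * \<i> * of_real a * z)) / norm (den z) \<le> 1"
        unfolding den_def using wave_kernel_vertical[OF that(1), of a] \<kappa> by (simp add: divide_le_eq_1)
    qed (use that N h in auto)
    finally show ?thesis by simp
  qed
  have cont: "continuous_on (path_image (rectpath p q)) (\<lambda>z. num z / den z)"
    using holomorphic_on_imp_continuous_on[OF holo] continuous_on_subset img by blast
  have lt: "1/2 < real N - 1/2" "- h < h" using N h by auto
  note R = contour_integral_rectpath[OF lt cont[unfolded p_def q_def]]
  have bot: "norm (contour_integral (linepath (Complex (1/2) (-h)) (Complex (real N - 1/2) (-h))) (\<lambda>z. num z / den z))
      \<le> H * norm (Complex (real N - 1/2) (-h) - Complex (1/2) (-h))"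
    by (rule contour_integral_bound_linepath[OF R(2)])
       (use bH h N in \<open>auto simp: H_def closed_segment_same_Im closed_segment_eq_real_ivl\<close>)
  have "norm (Complex (real N - 1/2) (-h) - Complex (1/2) (-h)) = real N - 1"
    using N by (simp add: complex_norm complex_diff)
  with bot have bot: "norm (contour_integral (linepath (Complex (1/2) (-h)) (Complex (real N - 1/2) (-h))) (\<lambda>z. num z / den z))
      \<le> (real N - 1) * H" by (simp only: mult.commute)
  have sides: "norm (contour_integral (rectpath p q) (\<lambda>z. num z / den z)
      - contour_integral (linepath (Complex (1/2) (-h)) (Complex (real N - 1/2) (-h))) (\<lambda>z. num z / den z))
      \<le> 2 * (h - - h) * exp (- (real N / (4 * h\<^sup>2))) + (real N - 1/2 - 1/2) * H"
    unfolding p_def q_def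
    by (rule contour_integral_rectpath_sides[OF lt cont[unfolded p_def q_def] bV bH]) (use h in auto)
  have "0 \<le> H" by (simp add: H_def)
  then have "2 * ((real N - 1) * H) \<le> 4 * real N * exp (- (2 * pi * \<kappa> * h))"
    by (simp add: H_def algebra_simps)
  then have arith: "(2 * (h - - h) * exp (- (real N / (4 * h\<^sup>2))) + (real N - 1/2 - 1/2) * H) + (real N - 1) * H
      \<le> 4 * h * exp (- (real N / (4 * h\<^sup>2))) + 4 * real N * exp (- (2 * pi * \<kappa> * h))"
    by (simp add: algebra_simps)
  define L where "L = contour_integral (linepath (Complex (1/2) (-h)) (Complex (real N - 1/2) (-h))) (\<lambda>z. num z / den z)"
  have "norm (contour_integral (rectpath p q) (\<lambda>z. num z / den z))
      \<le> norm (contour_integral (rectpath p q) (\<lambda>z. num z / den z) - L) + norm L"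
    using norm_triangle_sub[of "contour_integral (rectpath p q) (\<lambda>z. num z / den z)" L] by (simp only: add.commute)
  also have "\<dots> \<le> (2 * (h - - h) * exp (- (real N / (4 * h\<^sup>2))) + (real N - 1/2 - 1/2) * H) + (real N - 1) * H"
    unfolding L_def by (intro add_mono sides bot)
  also note arith
  finally show ?thesis unfolding eq .
qed

text \<open>Cauchy's theorem on a rectangle that rests on the real axis; a wave of positive frequency decays
  upwards.\<close>

lemma bump_exponential_integral_bound_pos:
  assumes T: "1 < T" and h: "1 \<le> h" and a: "0 < \<kappa>" "\<kappa> \<le> a"
  shows "norm (integral {1/2..T - 1/2} (\<lambda>s. of_real (bump (s / T)) * cis (2 * pi * a * s)))
         \<le> 2 * h * exp (- (T / (4 * h\<^sup>2))) + T * exp (- (2 * pi * \<kappa> * h))"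
proof -
  define S where "S = {z. 0 < Re z \<and> Re z < T}"
  define f where "f z = bump_ext T z * exp (2 * of_real pi * \<i> * of_real a * z)" for z
  have S: "open S" "convex S" unfolding S_def by (rule open_convex_vertical_strip)+
  have holo: "f holomorphic_on S"
    unfolding f_def S_def by (intro holomorphic_intros holomorphic_bump_ext)
  define p q where "p = Complex (1/2) 0" and "q = Complex (T - 1/2) h"
  have lt: "1/2 < T - 1/2" "0 < h" using T h by auto
  have img: "path_image (rectpath p q) \<subseteq> S"
    using path_image_rectpath_subset_cbox[of p q] lt
    by (force simp: p_def q_def in_cbox_complex_iff S_def)
  have zero: "contour_integral (rectpath p q) f = 0"
    using Cauchy_theorem_convex_simple[OF holo S(2) _ img] by (auto intro: contour_integral_unique)
  have cont: "continuous_on (path_image (rectpath p q)) f"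
    using holomorphic_on_imp_continuous_on[OF holo] continuous_on_subset img by blast
  have w: "exp (- (2 * pi * a * y)) \<le> exp (- (2 * pi * \<kappa> * y))" if "0 \<le> y" for y
    using that a by (simp add: mult_right_mono)
  have "norm (contour_integral (rectpath p q) f - contour_integral (linepath (Complex (1/2) 0) (Complex (T - 1/2) 0)) f)
      \<le> 2 * (h - 0) * exp (- (T / (4 * h\<^sup>2))) + (T - 1/2 - 1/2) * exp (- (2 * pi * \<kappa> * h))"
    unfolding p_def q_def
  proof (rule contour_integral_rectpath_sides[OF lt cont[unfolded p_def q_def]])
    fix z assume z: "Re z = 1/2 \<or> Re z = T - 1/2" "0 \<le> Im z" "Im z \<le> h"
    have "norm (f z) = norm (bump_ext T z) * exp (- (2 * pi * a * Im z))"
      unfolding f_def norm_mult norm_exp_wave ..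
    also have "\<dots> \<le> exp (- (T / (4 * h\<^sup>2))) * 1"
      using z T h a by (intro mult_mono norm_bump_ext_side) auto
    finally show "norm (f z) \<le> exp (- (T / (4 * h\<^sup>2)))" by simp
  next
    fix z assume z: "Im z = h" "1/2 \<le> Re z" "Re z \<le> T - 1/2"
    have "norm (f z) = norm (bump_ext T z) * exp (- (2 * pi * a * Im z))"
      unfolding f_def norm_mult norm_exp_wave ..
    also have "\<dots> \<le> 1 * exp (- (2 * pi * \<kappa> * h))"
      using z T w[of h] lt unfolding z(1) by (intro mult_mono norm_bump_ext_le) auto
    finally show "norm (f z) \<le> exp (- (2 * pi * \<kappa> * h))" by simp
  qed
  also have "contour_integral (linepath (Complex (1/2) 0) (Complex (T - 1/2) 0)) f
      = integral {1/2..T - 1/2} (\<lambda>s. f (of_real s))"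
    using lt by (subst contour_integral_linepath_Reals_eq) (auto simp: complex_is_Real_iff)
  also have "\<dots> = integral {1/2..T - 1/2} (\<lambda>s. of_real (bump (s / T)) * cis (2 * pi * a * s))"
  proof (rule integral_cong)
    fix s assume "s \<in> {1/2..T - 1/2}"
    then show "f (of_real s) = of_real (bump (s / T)) * cis (2 * pi * a * s)"
      using bump_ext_of_real[of s T] exp_wave_of_real[of a s] by (simp add: f_def)
  qed
  finally have "norm (integral {1/2..T - 1/2} (\<lambda>s. of_real (bump (s / T)) * cis (2 * pi * a * s)))
      \<le> 2 * h * exp (- (T / (4 * h\<^sup>2))) + (T - 1/2 - 1/2) * exp (- (2 * pi * \<kappa> * h))"
    unfolding zero by (simp only: diff_0 norm_minus_cancel diff_0_right)
  also have "\<dots> \<le> 2 * h * exp (- (T / (4 * h\<^sup>2))) + T * exp (- (2 * pi * \<kappa> * h))"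
    by (intro add_left_mono mult_right_mono) auto
  finally show ?thesis .
qed

text \<open>Conjugation reverses the frequency, since the weight is real.\<close>

lemma bump_exponential_integral_bound:
  assumes T: "1 < T" and h: "1 \<le> h" and a: "0 < \<kappa>" "\<kappa> \<le> \<bar>a\<bar>"
  shows "norm (integral {1/2..T - 1/2} (\<lambda>s. of_real (bump (s / T)) * cis (2 * pi * a * s)))
         \<le> 2 * h * exp (- (T / (4 * h\<^sup>2))) + T * exp (- (2 * pi * \<kappa> * h))"
proof (cases "a \<ge> 0")
  case True
  then show ?thesis
    using bump_exponential_integral_bound_pos[OF T h a(1), of a] a(2) by (simp only: abs_of_nonneg)
next
  case False
  have "integral {1/2..T - 1/2} (\<lambda>s. of_real (bump (s / T)) * cis (2 * pi * a * s))
    = integral {1/2..T - 1/2} (\<lambda>s. cnj (of_real (bump (s / T)) * cis (2 * pi * (- a) * s)))"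
    by (simp only: complex_cnj_mult complex_cnj_complex_of_real cis_cnj mult_minus_right mult_minus_left minus_minus)
  also have "\<dots> = cnj (integral {1/2..T - 1/2} (\<lambda>s. of_real (bump (s / T)) * cis (2 * pi * (- a) * s)))"
    by (rule integral_cnj[symmetric])
  finally show ?thesis
    unfolding complex_mod_cnj using bump_exponential_integral_bound_pos[OF T h a(1), of "- a"] a(2) False
    by (simp only: abs_of_neg not_le complex_mod_cnj)
qed

section \<open>The two weighted means\<close>

text \<open>Near the endpoint \<open>0\<close> this linear bound is enough to see that the weight is continuous.\<close>

lemma bump_le_self:
  assumes "0 < x" shows "bump x \<le> x"
proof (cases "x < 1")
  case True
  have "1 / x \<le> inverse x * inverse (1 - x)"
    using assms True mult_left_mono[of 1 "inverse (1 - x)" "inverse x"] by (simp add: field_simps)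
  then have "bump x \<le> exp (- (1 / x))" using assms True by (simp add: bump_def)
  also have "\<dots> \<le> 1 / (1 / x)"
  proof -
    have "1 / x \<le> exp (1 / x)" using exp_ge_add_one_self[of "1 / x"] by linarith
    then show ?thesis using assms by (simp add: exp_minus field_simps)
  qed
  finally show ?thesis by simp
qed (use assms in \<open>simp add: bump_def\<close>)

lemma bump_reflect: "bump (1 - x) = bump x"
  by (simp add: bump_def mult.commute)

lemma isCont_bump_0: "isCont bump 0"
proof -
  have "norm (bump x) \<le> norm x" for x
    using bump_le_self[of x] bump_nonneg[of x] by (cases "0 < x") (auto simp: bump_def)
  then have "\<forall>\<^sub>F x in at 0. norm (bump x) \<le> norm x"
    by (intro always_eventually allI)
  moreover have "((\<lambda>x::real. norm x) \<longlongrightarrow> 0) (at 0)"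
    by (intro tendsto_norm_zero tendsto_ident_at)
  ultimately have "(bump \<longlongrightarrow> 0) (at 0)"
    by (rule Lim_null_comparison)
  then show ?thesis by (simp add: isCont_def bump_def)
qed

lemma continuous_bump: "continuous_on A bump"
proof -
  have "isCont bump x" for x
  proof -
    consider "x < 0" | "x = 0" | "0 < x" "x < 1" | "x = 1" | "1 < x" by linarith
    then show ?thesis
    proof cases
      case 1
      have "continuous_on {..<0} bump"
        by (subst continuous_on_cong[OF refl, where g = "\<lambda>_. 0"]) (auto simp: bump_def)
      then show ?thesis using 1 by (simp add: continuous_on_eq_continuous_at)
    next
      case 3
      have "continuous_on {0<..<1} bump"
      proof (subst continuous_on_cong[OF refl])
        show "continuous_on {0<..<1} (\<lambda>x::real. exp (- (inverse x * inverse (1 - x))))"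
          by (intro continuous_intros) auto
      qed (simp add: bump_def)
      then show ?thesis using 3 by (simp add: continuous_on_eq_continuous_at)
    next
      case 4
      have "isCont (\<lambda>y. bump (1 - y)) x"
        using isCont_bump_0 4 by (intro isCont_o2[where g = bump and f = "\<lambda>y. 1 - y"] continuous_intros) auto
      then show ?thesis by (simp add: bump_reflect)
    next
      case 5
      have "continuous_on {1<..} bump"
        by (subst continuous_on_cong[OF refl, where g = "\<lambda>_. 0"]) (auto simp: bump_def)
      then show ?thesis using 5 by (simp add: continuous_on_eq_continuous_at)
    qed (simp add: isCont_bump_0)
  qed
  then show ?thesis by (intro continuous_at_imp_continuous_on ballI)
qed

text \<open>The bound is \<open>exp (- 1 / (x (1 - x)))\<close> at \<open>x = 1/3\<close>, where \<open>x (1 - x) = 2/9\<close>.\<close>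

lemma bump_ge:
  assumes "1/3 \<le> x" "x \<le> 2/3"
  shows "exp (- (9/2)) \<le> bump x"
proof -
  have "0 \<le> (x - 1/3) * (2/3 - x)" using assms by (intro mult_nonneg_nonneg) auto
  moreover have "(x - 1/3) * (2/3 - x) = x * (1 - x) - 2/9" by (simp add: field_simps)
  ultimately have "2/9 \<le> x * (1 - x)" by linarith
  then have "inverse (x * (1 - x)) \<le> inverse (2/9)" by (intro le_imp_inverse_le) auto
  then show ?thesis using assms by (simp add: bump_def)
qed

definition bump_mass :: real where "bump_mass = integral {0..1} bump"

lemma bump_mass_pos: "0 < bump_mass"
proof -
  have "integral {1/3..2/3} (\<lambda>x::real. exp (- (9/2))) \<le> integral {1/3..2/3} bump"
    by (intro integral_le integrable_continuous_real continuous_bump bump_ge) auto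
  also have "\<dots> \<le> integral {0..1} bump"
    by (intro integral_subset_le integrable_continuous_real continuous_bump) (auto simp: bump_nonneg)
  finally have "exp (- (9/2)) / 3 \<le> bump_mass" by (simp add: bump_mass_def)
  moreover have "0 < exp (- (9/2) :: real) / 3" by simp
  ultimately show ?thesis by linarith
qed

lemma lborel_integral_bump: "(LINT t|lborel. bump t) = bump_mass"
proof -
  have "(LINT t|lborel. bump t) = (LINT t:{0..1}|lborel. bump t)"
    unfolding set_lebesgue_integral_def by (intro Bochner_Integration.integral_cong) (auto simp: bump_def indicator_def)
  also have "\<dots> = bump_mass"
    unfolding bump_mass_def
    by (intro set_borel_integral_eq_integral(2) borel_integrable_atLeastAtMost' continuous_bump)
  finally show ?thesis .
qed

lemma weight_eq: "weight x = bump x / bump_mass"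
proof -
  have "(LINT t:{0<..<1}|lborel. exp (- (inverse t * inverse (1 - t)))) = (LINT t|lborel. bump t)"
    unfolding set_lebesgue_integral_def by (intro Bochner_Integration.integral_cong) (auto simp: bump_def indicator_def)
  then show ?thesis unfolding weight_def lborel_integral_bump by (simp add: bump_def)
qed

lemma weight_nonneg: "0 \<le> weight x"
  using bump_mass_pos by (simp add: weight_eq bump_nonneg)

lemma continuous_weight: "continuous_on A (\<lambda>s. weight (s / T))"
proof -
  have "continuous_on A (\<lambda>s. s / T)"
    unfolding divide_inverse by (intro continuous_intros)
  then have "continuous_on A (\<lambda>s. bump (s / T))"
    by (rule continuous_on_compose2[OF continuous_bump[of UNIV]]) auto
  then show ?thesis
    unfolding weight_eq by (rule continuous_on_divide[OF _ continuous_on_const]) (use bump_mass_pos in simp)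
qed

lemma integral_weight:
  assumes "0 < T" shows "integral {0..T} (\<lambda>s. weight (s / T)) = T"
proof -
  have "integral {0..T} (\<lambda>s. weight (s / T)) = (LINT s:{0..T}|lborel. weight (s / T))"
    by (intro set_borel_integral_eq_integral(2)[symmetric] borel_integrable_atLeastAtMost' continuous_weight)
  also have "\<dots> = (LINT s|lborel. weight (s / T))"
  proof -
    have "weight (s / T) = 0" if "s \<notin> {0..T}" for s
      using that assms by (auto simp: weight_def zero_less_divide_iff divide_less_eq_1)
    then show ?thesis
      unfolding set_lebesgue_integral_def by (intro Bochner_Integration.integral_cong) (auto simp: indicator_def)
  qed
  also have "\<dots> = T * (LINT s|lborel. weight s)"
    using assms by (subst lborel_integral_real_affine[where c = T and t = 0]) auto
  also have "(LINT s|lborel. weight s) = 1"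
    using bump_mass_pos by (simp add: weight_eq lborel_integral_bump)
  finally show ?thesis by simp
qed

text \<open>The means \<open>DMW\<close> and \<open>CMW\<close> as functionals of the observed signal, so that they can be evaluated on
  single waves and extended by linearity.\<close>

definition dmean :: "nat \<Rightarrow> (real \<Rightarrow> complex) \<Rightarrow> complex" where
  "dmean N f = (1 / complex_of_real (\<Sum>n<N. weight (real n / real N))) *
     (\<Sum>n<N. complex_of_real (weight (real n / real N)) * f (real n))"

definition cmean :: "real \<Rightarrow> (real \<Rightarrow> complex) \<Rightarrow> complex" where
  "cmean T f = (1 / complex_of_real T) * integral {0..T} (\<lambda>s. complex_of_real (weight (s / T)) * f s)"

lemma sum_weight_nonneg: "0 \<le> (\<Sum>n<N. weight (real n / real N))"
  by (intro sum_nonneg weight_nonneg)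

text \<open>A single sample near the midpoint already keeps the normalising sum away from zero. The true size is
  of order \<open>N\<close>, but the stretched exponential gain absorbs that loss.\<close>

lemma sum_bump_ge:
  assumes "2 \<le> N" shows "exp (- (9/2)) \<le> (\<Sum>n<N. bump (real n / real N))"
proof -
  have m: "N div 2 < N" "3 * (N div 2) \<ge> N" "2 * (N div 2) \<le> N" using assms by presburger+
  then have "real N \<le> 3 * real (N div 2)" "2 * real (N div 2) \<le> real N" by linarith+
  then have "exp (- (9/2)) \<le> bump (real (N div 2) / real N)"
    using assms by (intro bump_ge) (auto simp: field_simps)
  also have "\<dots> \<le> (\<Sum>n<N. bump (real n / real N))"
    using m by (intro member_le_sum) (auto simp: bump_nonneg)
  finally show ?thesis .
qed

lemma norm_dmean_le:
  assumes "\<And>s. norm (f s) \<le> B"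
  shows "norm (dmean N f) \<le> B"
proof -
  have B: "0 \<le> B" using assms[of 0] norm_ge_zero order_trans by blast
  define W where "W = (\<Sum>n<N. weight (real n / real N))"
  have W: "0 \<le> W" unfolding W_def by (rule sum_weight_nonneg)
  have "norm (\<Sum>n<N. complex_of_real (weight (real n / real N)) * f (real n))
      \<le> (\<Sum>n<N. weight (real n / real N) * B)"
    by (intro sum_norm_le) (auto simp: norm_mult weight_nonneg intro!: mult_left_mono assms)
  also have "\<dots> = W * B" by (simp add: W_def sum_distrib_right)
  finally have "norm (dmean N f) \<le> norm (1 / complex_of_real W) * (W * B)"
    unfolding dmean_def norm_mult W_def[symmetric] by (intro mult_left_mono) auto
  also have "\<dots> \<le> B" using B W by (simp add: norm_divide)
  finally show ?thesis .
qed

lemma dmean_one: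
  assumes "2 \<le> N" shows "dmean N (\<lambda>_. 1) = 1"
proof -
  have "0 < (\<Sum>n<N. bump (real n / real N))"
    using sum_bump_ge[OF assms] exp_gt_zero[of "- (9/2) :: real"] by linarith
  then have "(\<Sum>n<N. weight (real n / real N)) \<noteq> 0"
    using bump_mass_pos by (simp add: weight_eq sum_divide_distrib[symmetric])
  then have "complex_of_real (\<Sum>n<N. weight (real n / real N)) \<noteq> 0"
    unfolding of_real_eq_0_iff .
  then show ?thesis by (simp add: dmean_def)
qed

lemma norm_cmean_le:
  assumes "0 < T" "continuous_on {0..T} f" "\<And>s. s \<in> {0..T} \<Longrightarrow> norm (f s) \<le> B"
  shows "norm (cmean T f) \<le> B"
proof -
  have "norm (integral {0..T} (\<lambda>s. complex_of_real (weight (s / T)) * f s))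
      \<le> integral {0..T} (\<lambda>s. weight (s / T) * B)"
    using assms
    by (intro integral_norm_bound_integral integrable_continuous_real continuous_intros continuous_weight)
       (auto simp: norm_mult weight_nonneg intro!: mult_left_mono)
  also have "\<dots> = T * B" using integral_weight[OF assms(1)] by simp
  finally show ?thesis using assms(1) by (simp add: cmean_def norm_mult norm_divide field_simps)
qed

lemma cmean_one:
  assumes "0 < T" shows "cmean T (\<lambda>_. 1) = 1"
proof -
  have "integral {0..T} (\<lambda>s. complex_of_real (weight (s / T))) = complex_of_real (integral {0..T} (\<lambda>s. weight (s / T)))"
    by (intro integral_unique has_integral_of_real integrable_integral integrable_continuous_real continuous_weight)
  then show ?thesis using assms by (simp add: cmean_def integral_weight)
qed

lemma cis_frac: "cis (2 * pi * frac a * real n) = cis (2 * pi * a * real n)"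
proof -
  have "2 * pi * a * real n = 2 * pi * frac a * real n + 2 * pi * real_of_int (\<lfloor>a\<rfloor> * int n)"
    unfolding frac_def of_int_mult of_int_of_nat_eq by algebra
  then have "cis (2 * pi * a * real n) = cis (2 * pi * frac a * real n) * cis (2 * pi * real_of_int (\<lfloor>a\<rfloor> * int n))"
    by (metis cis_mult)
  also have "cis (2 * pi * real_of_int (\<lfloor>a\<rfloor> * int n)) = 1"
    by (rule cis_multiple_2pi) (rule Ints_of_int)
  finally show ?thesis by simp
qed

definition wave :: "real \<Rightarrow> real \<Rightarrow> complex" where
  "wave a s = cis (2 * pi * a * s)"

lemma dmean_wave_decay:
  assumes N: "2 \<le> N" and h: "1 \<le> h" and \<kappa>: "0 < \<kappa>" "\<And>m :: int. \<kappa> \<le> \<bar>a - of_int m\<bar>"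
  shows "norm (dmean N (wave a))
    \<le> 4 * exp (9/2) * (h * exp (- (real N / (4 * h\<^sup>2))) + real N * exp (- (2 * pi * \<kappa> * h)))"
proof -
  let ?E = "h * exp (- (real N / (4 * h\<^sup>2))) + real N * exp (- (2 * pi * \<kappa> * h))"
  let ?W = "\<Sum>n<N. bump (real n / real N)"
  have "\<kappa> \<le> frac a" "frac a \<le> 1 - \<kappa>"
    using \<kappa>(2)[of "\<lfloor>a\<rfloor>"] \<kappa>(2)[of "\<lfloor>a\<rfloor> + 1"] frac_ge_0[of a] frac_lt_1[of a] by (auto simp: frac_def)
  from bump_exponential_sum_bound[OF N h \<kappa>(1) this]
  have "norm (\<Sum>n\<in>{1..<N}. of_real (bump (real n / real N)) * cis (2 * pi * a * real n)) \<le> 4 * ?E"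
    unfolding cis_frac by (simp add: algebra_simps)
  also have "(\<Sum>n\<in>{1..<N}. of_real (bump (real n / real N)) * cis (2 * pi * a * real n))
      = (\<Sum>n<N. of_real (bump (real n / real N)) * cis (2 * pi * a * real n))"
    by (intro sum.mono_neutral_left) (auto simp: bump_def Suc_le_eq)
  finally have num: "norm (\<Sum>n<N. of_real (bump (real n / real N)) * cis (2 * pi * a * real n)) \<le> 4 * ?E" .
  have "dmean N (wave a) = (\<Sum>n<N. of_real (bump (real n / real N)) * cis (2 * pi * a * real n)) / of_real ?W"
    using bump_mass_pos
    by (simp add: dmean_def wave_def weight_eq sum_divide_distrib[symmetric])
  also have "norm \<dots> \<le> 4 * ?E / exp (- (9/2))"
    unfolding norm_divide norm_of_real
    by (rule frac_le[OF order_trans[OF norm_ge_zero num] num]) (use sum_bump_ge[OF N] in auto)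
  also have "\<dots> = 4 * exp (9/2) * ?E"
    by (simp only: exp_minus divide_inverse_commute[of "4 * _"] inverse_inverse_eq mult_ac)
  finally show ?thesis .
qed

lemma continuous_wave: "continuous_on A (wave a)"
  unfolding wave_def by (intro continuous_intros)

lemma norm_wave: "norm (wave a s) = 1"
  by (simp add: wave_def)

lemma bump_le_near_endpoint:
  assumes "1 < T" "0 \<le> s" "s \<le> T" "s \<le> 1/2 \<or> T - 1/2 \<le> s"
  shows "bump (s / T) \<le> exp (- T)"
proof -
  have left: "bump x \<le> exp (- T)" if "x \<le> 1 / (2 * T)" for x
  proof (cases "0 < x \<and> x < 1")
    case True
    then have "x * (1 - x) \<le> x * 1" by (intro mult_left_mono) auto
    also have "\<dots> \<le> 1 / T" using that assms(1) by (simp add: field_simps)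
    finally have "inverse (1 / T) \<le> inverse (x * (1 - x))"
      using True by (intro le_imp_inverse_le) auto
    then show ?thesis using True by (simp add: bump_def)
  next
    case False
    then have "bump x = 0" by (simp add: bump_def)
    then show ?thesis by simp
  qed
  show ?thesis
  proof (cases "s \<le> 1/2")
    case True
    then show ?thesis using assms by (intro left) (simp add: field_simps)
  next
    case False
    then have "(T - 1/2) / T \<le> s / T" using assms by (intro divide_right_mono) auto
    then have "1 - s / T \<le> 1 / (2 * T)" using assms(1) by (simp add: diff_divide_distrib)
    from left[OF this] show ?thesis by (simp add: bump_reflect)
  qed
qed

text \<open>The contour argument covers \<open>[1/2, T - 1/2]\<close>; on the two remaining half units the
  unnormalised weight is at most \<open>exp (- T)\<close>.\<close>

lemma cmean_wave_decay:
  assumes T: "1 < T" and h: "1 \<le> h" and \<kappa>: "0 < \<kappa>" "\<kappa> \<le> \<bar>a\<bar>"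
  shows "norm (cmean T (wave a))
    \<le> 3 / bump_mass * (h * exp (- (T / (4 * h\<^sup>2))) + T * exp (- (2 * pi * \<kappa> * h)))"
proof -
  let ?f = "\<lambda>s. of_real (bump (s / T)) * cis (2 * pi * a * s) :: complex"
  let ?e1 = "h * exp (- (T / (4 * h\<^sup>2)))" and ?e2 = "T * exp (- (2 * pi * \<kappa> * h))"
  have cont: "continuous_on A ?f" for A
    by (intro continuous_intros continuous_on_compose2[OF continuous_bump[of UNIV]]) (use T in auto)
  have int: "?f integrable_on {u..v}" for u v
    by (intro integrable_continuous_real cont)
  have ends: "norm (integral {u..v} ?f) \<le> exp (- T) * (v - u)"
    if uv: "u \<le> v" "0 \<le> u" "v \<le> T" "v \<le> 1/2 \<or> T - 1/2 \<le> u" for u v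
  proof (intro integral_bound cont uv(1))
    fix s assume "s \<in> {u..v}"
    then have "bump (s / T) \<le> exp (- T)" using uv T by (intro bump_le_near_endpoint) auto
    then show "norm (?f s) \<le> exp (- T)" by (simp add: norm_mult bump_nonneg)
  qed
  have "integral {0..T} ?f = integral {0..1/2} ?f + integral {1/2..T - 1/2} ?f + integral {T - 1/2..T} ?f"
    using T Henstock_Kurzweil_Integration.integral_combine[OF _ _ int, of 0 "1/2" "T - 1/2"]
      Henstock_Kurzweil_Integration.integral_combine[OF _ _ int, of 0 "T - 1/2" T]
    by simp
  also have "norm \<dots> \<le> exp (- T) / 2 + (2 * ?e1 + ?e2) + exp (- T) / 2"
  proof (intro norm_triangle_mono)
    show "norm (integral {0..1/2} ?f) \<le> exp (- T) / 2" using ends[of 0 "1/2"] T by simp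
    show "norm (integral {T - 1/2..T} ?f) \<le> exp (- T) / 2" using ends[of "T - 1/2" T] T by simp
    show "norm (integral {1/2..T - 1/2} ?f) \<le> 2 * ?e1 + ?e2"
      using bump_exponential_integral_bound[OF T h \<kappa>] by (simp add: mult.assoc)
  qed
  finally have split: "norm (integral {0..T} ?f) \<le> exp (- T) / 2 + (2 * ?e1 + ?e2) + exp (- T) / 2" .
  have "exp (- T) \<le> ?e1"
  proof -
    have "1 \<le> h\<^sup>2" using h by simp
    then have "1 \<le> 4 * h\<^sup>2" by linarith
    then have "T / (4 * h\<^sup>2) \<le> T / 1" using T by (intro divide_left_mono) auto
    then have "exp (- T) \<le> 1 * exp (- (T / (4 * h\<^sup>2)))" by simp
    also have "\<dots> \<le> ?e1" using h by (intro mult_right_mono) auto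
    finally show ?thesis .
  qed
  moreover have "0 \<le> ?e2" using T by simp
  moreover have "x \<le> 3 * (y + z)" if "x \<le> w / 2 + (2 * y + z) + w / 2" "w \<le> y" "0 \<le> z"
    for x y z w :: real
    using that by (simp add: field_simps)
  ultimately have num: "norm (integral {0..T} ?f) \<le> 3 * (?e1 + ?e2)"
    using split by simp
  have "cmean T (wave a) = (1 / of_real T) * integral {0..T} (\<lambda>s. of_real (1 / bump_mass) * ?f s)"
  proof -
    have "complex_of_real (weight (s / T)) * wave a s = of_real (1 / bump_mass) * ?f s" for s
      by (simp add: weight_eq wave_def)
    then show ?thesis unfolding cmean_def by (simp only:)
  qed
  also have "integral {0..T} (\<lambda>s. of_real (1 / bump_mass) * ?f s) = of_real (1 / bump_mass) * integral {0..T} ?f"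
    by (rule integral_mult_right)
  finally have "norm (cmean T (wave a)) = (1 / T) * (1 / bump_mass * norm (integral {0..T} ?f))"
    using T bump_mass_pos by (simp only: norm_mult norm_divide norm_of_real norm_one abs_of_pos abs_of_nonneg
        zero_le_divide_1_iff less_imp_le mult.assoc order_less_trans[OF zero_less_one])
  also have "\<dots> \<le> 1 * (1 / bump_mass * (3 * (?e1 + ?e2)))"
  proof (rule mult_mono)
    show "1 / bump_mass * norm (integral {0..T} ?f) \<le> 1 / bump_mass * (3 * (?e1 + ?e2))"
      by (rule mult_left_mono[OF num]) (use bump_mass_pos in simp)
  qed (use T bump_mass_pos in simp_all)
  also have "\<dots> = 3 / bump_mass * (?e1 + ?e2)" by simp
  finally show ?thesis .
qed

section \<open>Small divisors\<close>

lemma norm_summable_prod_fun: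
  fixes f :: "'a::finite \<Rightarrow> 'b::countable \<Rightarrow> 'c::{real_normed_field,banach,second_countable_topology}"
  assumes "\<And>x. (\<lambda>y. norm (f x y)) summable_on UNIV"
  shows "(\<lambda>g. norm (\<Prod>x\<in>UNIV. f x (g x))) summable_on UNIV"
proof -
  have "Infinite_Set_Sum.abs_summable_on (f x) UNIV" for x
    using assms[of x] abs_summable_equivalent by blast
  then have "Infinite_Set_Sum.abs_summable_on (\<lambda>g. \<Prod>x\<in>UNIV. f x (g x)) (PiE UNIV (\<lambda>_. UNIV))"
    by (intro abs_summable_on_prod_PiE) auto
  then show ?thesis
    using abs_summable_equivalent[of "\<lambda>g. \<Prod>x\<in>UNIV. f x (g x)" UNIV] by (simp add: PiE_UNIV_domain)
qed

lemma summable_on_vec_iff: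
  fixes f :: "('d::finite \<Rightarrow> 'b) \<Rightarrow> 'c::{comm_monoid_add,t2_space}"
  shows "(\<lambda>k :: 'b ^ 'd. f (vec_nth k)) summable_on UNIV \<longleftrightarrow> f summable_on UNIV"
proof (rule summable_on_reindex_bij_betw)
  show "bij_betw (vec_nth :: 'b ^ 'd \<Rightarrow> 'd \<Rightarrow> 'b) UNIV UNIV"
    by (intro bij_betw_byWitness[where f' = vec_lambda]) (auto simp: vec_lambda_inverse)
qed

lemma summable_on_int_inverse_square: "(\<lambda>k::int. 1 / (1 + \<bar>real_of_int k\<bar>)\<^sup>2) summable_on UNIV"
proof -
  have "summable (\<lambda>n. 1 / (real (Suc n))\<^sup>2)"
    using inverse_power_summable[of 2, where 'a = real] summable_Suc_iff[of "\<lambda>n. inverse (real n ^ 2)"]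
    by (simp add: divide_inverse)
  then have nat: "(\<lambda>n. 1 / (1 + real n)\<^sup>2) summable_on UNIV"
    by (subst summable_on_UNIV_nonneg_real_iff) auto
  have "(\<lambda>k::int. 1 / (1 + \<bar>real_of_int k\<bar>)\<^sup>2) summable_on range int"
    using nat by (subst summable_on_reindex) (auto simp: o_def)
  moreover have "(\<lambda>k::int. 1 / (1 + \<bar>real_of_int k\<bar>)\<^sup>2) summable_on range (\<lambda>n. - int n)"
    using nat by (subst summable_on_reindex) (auto simp: o_def inj_on_def)
  ultimately have "(\<lambda>k::int. 1 / (1 + \<bar>real_of_int k\<bar>)\<^sup>2) summable_on (range int \<union> range (\<lambda>n. - int n))"
    by (rule summable_on_union)
  also have "range int \<union> range (\<lambda>n. - int n) = UNIV"
  proof -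
    have "k \<in> range int \<union> range (\<lambda>n. - int n)" for k
      by (cases k rule: int_cases2) auto
    then show ?thesis by blast
  qed
  finally show ?thesis .
qed

definition phase :: "('l::finite \<Rightarrow> int ^ 'd::finite) \<Rightarrow> real ^ 'd ^ 'l \<Rightarrow> real" where
  "phase K \<rho> = (\<Sum>j\<in>UNIV. \<Sum>i\<in>UNIV. of_int (K j $ i) * \<rho> $ j $ i)"

text \<open>A size of \<open>K\<close> chosen so that \<open>1 / height K\<close> is summable over all tuples and so that it is a
  natural number, which makes it a legitimate count of translates in \<open>emeasure_near_resonance\<close>.\<close>

definition height :: "('l::finite \<Rightarrow> int ^ 'd::finite) \<Rightarrow> nat" where
  "height K = (\<Prod>j\<in>UNIV. \<Prod>i\<in>UNIV. (1 + nat \<bar>K j $ i\<bar>)\<^sup>2)"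

lemma height_pos: "0 < height K"
  unfolding height_def by (intro prod_pos ballI) simp

lemma summable_on_inverse_height:
  "(\<lambda>K :: 'l::finite \<Rightarrow> int ^ 'd::finite. 1 / real (height K)) summable_on UNIV"
proof -
  have "(\<lambda>g :: 'd \<Rightarrow> int. norm (\<Prod>i\<in>UNIV. 1 / (1 + \<bar>real_of_int (g i)\<bar>)\<^sup>2)) summable_on UNIV"
    using summable_on_int_inverse_square by (intro norm_summable_prod_fun) simp
  then have "(\<lambda>k :: int ^ 'd. norm (\<Prod>i\<in>UNIV. 1 / (1 + \<bar>real_of_int (k $ i)\<bar>)\<^sup>2)) summable_on UNIV"
    by (subst (asm) summable_on_vec_iff[symmetric])
  then have "(\<lambda>K :: 'l \<Rightarrow> int ^ 'd. norm (\<Prod>j\<in>UNIV. \<Prod>i\<in>UNIV. 1 / (1 + \<bar>real_of_int (K j $ i)\<bar>)\<^sup>2)) summable_on UNIV"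
    by (intro norm_summable_prod_fun[where f = "\<lambda>j k. \<Prod>i\<in>UNIV. 1 / (1 + \<bar>real_of_int (k $ i)\<bar>)\<^sup>2"])
  also have "(\<lambda>K :: 'l \<Rightarrow> int ^ 'd. norm (\<Prod>j\<in>UNIV. \<Prod>i\<in>UNIV. 1 / (1 + \<bar>real_of_int (K j $ i)\<bar>)\<^sup>2))
      = (\<lambda>K. 1 / real (height K))"
  proof
    fix K :: "'l \<Rightarrow> int ^ 'd"
    have "real (height K) = (\<Prod>j\<in>UNIV. \<Prod>i\<in>UNIV. (1 + \<bar>real_of_int (K j $ i)\<bar>)\<^sup>2)"
      unfolding height_def by simp
    then show "norm (\<Prod>j\<in>UNIV. \<Prod>i\<in>UNIV. 1 / (1 + \<bar>real_of_int (K j $ i)\<bar>)\<^sup>2) = 1 / real (height K)"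
      by (simp add: prod_dividef prod_nonneg prod_norm[symmetric])
  qed
  finally show ?thesis .
qed

definition near_resonance :: "('l::finite \<Rightarrow> int ^ 'd::finite) \<Rightarrow> real \<Rightarrow> (real ^ 'd ^ 'l) set" where
  "near_resonance K \<epsilon> = {\<rho> \<in> torus_power. \<exists>n::int. \<bar>phase K \<rho> - of_int n\<bar> < \<epsilon>}"

lemma continuous_phase: "continuous_on A (phase K)"
  unfolding phase_def by (intro continuous_intros)

lemma torus_power_cbox: "(torus_power :: (real ^ 'd::finite ^ 'l::finite) set) = cbox 0 (\<chi> j i. 1)"
  by (auto simp: torus_power_def torus_def mem_box_cart set_eq_iff less_eq_vec_def cbox_def
      inner_axis Basis_vec_def)

lemma near_resonance_borel [measurable]: "near_resonance K \<epsilon> \<in> sets borel"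
proof -
  have "near_resonance K \<epsilon> = torus_power \<inter> (\<Union>n::int. {\<rho>. \<bar>phase K \<rho> - of_int n\<bar> < \<epsilon>})"
    by (auto simp: near_resonance_def)
  moreover have "open {\<rho>. \<bar>phase K \<rho> - of_int n\<bar> < \<epsilon>}" for n :: int
    by (intro open_Collect_less continuous_intros continuous_phase)
  ultimately show ?thesis
    by (simp add: torus_power_cbox borel_open sets.Int open_UN)
qed

definition double_cube :: "(real ^ 'd::finite ^ 'l::finite) set" where
  "double_cube = {\<rho>. \<forall>j i. 0 \<le> \<rho> $ j $ i \<and> \<rho> $ j $ i \<le> 2}"

lemma double_cube_cbox: "(double_cube :: (real ^ 'd::finite ^ 'l::finite) set) = cbox 0 (\<chi> j i. 2)"
  by (auto simp: double_cube_def mem_box_cart set_eq_iff less_eq_vec_def cbox_def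
      inner_axis Basis_vec_def)

text \<open>Moving \<open>\<rho>\<close> by \<open>1 / (P \<bar>k\<bar>)\<close> in a coordinate with \<open>k \<noteq> 0\<close> moves the phase by \<open>1 / P\<close>. The \<open>P\<close>
  successive translates of a \<open>1 / (2 P)\<close>-neighbourhood of the resonances are therefore disjoint; they
  all have the same measure and fit into the doubled cube.\<close>

lemma emeasure_near_resonance:
  fixes K :: "'l::finite \<Rightarrow> int ^ 'd::finite"
  assumes K: "K \<noteq> (\<lambda>_. 0)" and P: "0 < P"
  shows "emeasure lborel (near_resonance K (1 / (2 * real P)))
    \<le> ennreal (measure lborel (double_cube :: (real ^ 'd ^ 'l) set) / real P)"
proof -
  let ?B = "near_resonance K (1 / (2 * real P))"
  let ?D = "double_cube :: (real ^ 'd ^ 'l) set"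
  obtain j i where k: "K j $ i \<noteq> 0" using K by (auto simp: fun_eq_iff vec_eq_iff)
  define k where "k = real_of_int (K j $ i)"
  have k1: "1 \<le> \<bar>k\<bar>" using k by (auto simp: k_def)
  \<comment> \<open>A translation vector that shifts the phase by exactly plus or minus \<open>1 / P\<close>.\<close>
  define v :: "real ^ 'd ^ 'l" where "v = axis j (axis i (1 / (real P * \<bar>k\<bar>)))"
  define shifted where "shifted p = (+) (- (real p *\<^sub>R v)) -` ?B" for p :: nat
  have phase_shift: "phase K (- (real p *\<^sub>R v) + \<rho>) = phase K \<rho> - sgn k * real p / real P" for p \<rho>
  proof -
    have "phase K v = (\<Sum>j'\<in>UNIV. \<Sum>i'\<in>UNIV. if j' = j then if i' = i then sgn k / real P else 0 else 0)"
      unfolding phase_def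
    proof (intro sum.cong refl)
      fix j' i'
      show "real_of_int (K j' $ i') * v $ j' $ i' = (if j' = j then if i' = i then sgn k / real P else 0 else 0)"
        using k1 P by (auto simp: v_def axis_def k_def sgn_if field_simps abs_if)
    qed
    also have "\<dots> = (\<Sum>j'\<in>UNIV. if j' = j then sgn k / real P else 0)"
      by (intro sum.cong refl) simp
    also have "\<dots> = sgn k / real P" by simp
    finally have "phase K v = sgn k / real P" .
    moreover have "phase K (- (real p *\<^sub>R v) + \<rho>) = - (real p * phase K v) + phase K \<rho>"
      unfolding phase_def by (simp add: algebra_simps sum.distrib sum_negf sum_distrib_left sum_subtractf)
    ultimately show ?thesis by simp
  qed
  have meas: "shifted p \<in> sets borel" for p
    unfolding shifted_def by (rule measurable_sets_borel[OF _ near_resonance_borel]) measurable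
  have em: "emeasure lborel (shifted p) = emeasure lborel ?B" for p
  proof -
    have "emeasure lborel ?B = emeasure (distr lborel borel ((+) (- (real p *\<^sub>R v)))) ?B"
      by (simp add: lborel_distr_plus)
    also have "\<dots> = emeasure lborel (shifted p)"
      by (subst emeasure_distr) (simp_all add: shifted_def)
    finally show ?thesis by simp
  qed
  have disj: "disjoint_family_on shifted {..<P}"
  proof -
    have False if pq: "p < q" "q < P" and \<rho>: "\<rho> \<in> shifted p" "\<rho> \<in> shifted q" for p q \<rho>
    proof -
      obtain m n :: int where m: "\<bar>phase K \<rho> - sgn k * real p / real P - of_int m\<bar> < 1 / (2 * real P)"
        and n: "\<bar>phase K \<rho> - sgn k * real q / real P - of_int n\<bar> < 1 / (2 * real P)"
        using \<rho> unfolding shifted_def near_resonance_def vimage_eq mem_Collect_eq phase_shift by blast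
      have "\<bar>sgn k * (real q - real p) / real P + of_int (n - m)\<bar> < 1 / real P"
      proof -
        have "sgn k * (real q - real p) / real P + of_int (n - m)
          = (phase K \<rho> - sgn k * real p / real P - of_int m) - (phase K \<rho> - sgn k * real q / real P - of_int n)"
          by (simp add: algebra_simps diff_divide_distrib)
        moreover have "1 / real P = 1 / (2 * real P) + 1 / (2 * real P)" by simp
        ultimately show ?thesis using m n by linarith
      qed
      then have "real P * \<bar>sgn k * (real q - real p) / real P + of_int (n - m)\<bar> < real P * (1 / real P)"
        using P by (intro mult_strict_left_mono) auto
      also have "real P * \<bar>sgn k * (real q - real p) / real P + of_int (n - m)\<bar>
         = \<bar>real P * (sgn k * (real q - real p) / real P + of_int (n - m))\<bar>"
        by (simp add: abs_mult)
      also have "real P * (sgn k * (real q - real p) / real P + of_int (n - m))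
         = sgn k * (real q - real p) + real P * of_int (n - m)"
        using P by (simp add: distrib_left)
      finally have lt: "\<bar>sgn k * (real q - real p) + real P * of_int (n - m)\<bar> < 1" using P by simp
      \<comment> \<open>A point common to two translates gives an integer of absolute value below 1, hence 0, so that \<open>P\<close> divides \<open>q - p\<close>.\<close>
      have "\<exists>s::int. (s = 1 \<or> s = -1) \<and> sgn k = of_int s"
        using k1 by (intro exI[of _ "if k > 0 then 1 else -1"]) (auto simp: sgn_if)
      then obtain s :: int where s: "s = 1 \<or> s = -1" "sgn k = of_int s" by blast
      have "sgn k * (real q - real p) + real P * of_int (n - m)
          = real_of_int (s * (int q - int p) + int P * (n - m))"
        by (simp add: s(2))
      with lt have "\<bar>s * (int q - int p) + int P * (n - m)\<bar> < 1" by linarith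
      then have "s * (int q - int p) = int P * (m - n)" by (simp add: algebra_simps)
      then have "int P dvd s * (int q - int p)" by simp
      then have "int P dvd s * (s * (int q - int p))" by (rule dvd_mult)
      also have "s * (s * (int q - int p)) = int q - int p" using s(1) by auto
      finally have "int P dvd int q - int p" .
      from zdvd_imp_le[OF this] show False using pq by auto
    qed
    then show ?thesis
      unfolding disjoint_family_on_def by (auto simp: disjoint_iff) (metis nat_neq_iff)
  qed
  have sub: "(\<Union>p<P. shifted p) \<subseteq> ?D"
  proof
    fix \<rho> assume "\<rho> \<in> (\<Union>p<P. shifted p)"
    then obtain p where p: "p < P" and "- (real p *\<^sub>R v) + \<rho> \<in> torus_power"
      by (auto simp: shifted_def near_resonance_def)
    then have t: "0 \<le> \<rho> $ j' $ i' - real p * v $ j' $ i'" "\<rho> $ j' $ i' - real p * v $ j' $ i' \<le> 1" for j' i'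
      by (auto simp: torus_power_def torus_def)
    have v: "0 \<le> real p * v $ j' $ i'" "real p * v $ j' $ i' \<le> 1" for j' i'
    proof -
      have "real p \<le> real P * \<bar>k\<bar>"
        using p k1 mult_mono[of "real p" "real P" 1 "\<bar>k\<bar>"] by simp
      then have "real p * (1 / (real P * \<bar>k\<bar>)) \<le> 1" using P k1 by (simp add: divide_le_eq)
      then show "real p * v $ j' $ i' \<le> 1" by (simp add: v_def axis_def)
      show "0 \<le> real p * v $ j' $ i'" by (simp add: v_def axis_def)
    qed
    show "\<rho> \<in> ?D" unfolding double_cube_def
    proof (intro CollectI allI)
      fix j' i' show "0 \<le> \<rho> $ j' $ i' \<and> \<rho> $ j' $ i' \<le> 2"
        using t[of j' i'] v[of j' i'] by linarith
    qed
  qed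
  have "of_nat P * emeasure lborel ?B = (\<Sum>p<P. emeasure lborel (shifted p))"
    by (simp add: em)
  also have "\<dots> = emeasure lborel (\<Union>p<P. shifted p)"
    using meas by (intro sum_emeasure disj) auto
  also have "\<dots> \<le> emeasure lborel ?D"
    using sub by (intro emeasure_mono) (auto simp: double_cube_cbox)
  also have "\<dots> = ennreal (measure lborel ?D)"
    unfolding double_cube_cbox by (rule emeasure_eq_ennreal_measure[OF less_imp_neq[OF emeasure_lborel_cbox_finite[unfolded infinity_ennreal_def]]])
  finally have le: "of_nat P * emeasure lborel ?B \<le> ennreal (measure lborel ?D)" .
  have "emeasure lborel ?B = (of_nat P * emeasure lborel ?B) / of_nat P"
    unfolding mult.commute[of "of_nat P" "emeasure lborel ?B"]
    by (rule ennreal_mult_divide_eq[symmetric]) (use P in auto)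
  also have "\<dots> \<le> ennreal (measure lborel ?D) / of_nat P"
    using le by (rule divide_right_mono_ennreal)
  also have "\<dots> = ennreal (measure lborel ?D / real P)"
    using P by (simp add: divide_ennreal ennreal_of_nat_eq_real_of_nat)
  finally show ?thesis .
qed

text \<open>Parameters that violate the inequality for every constant lie, for each \<open>n\<close>, in a union of
  resonance neighbourhoods whose measures sum to at most a constant over \<open>n + 1\<close>.\<close>

lemma AE_diophantine:
  "AE \<rho> in lebesgue_on (torus_power :: (real ^ 'd::finite ^ 'l::finite) set).
     \<exists>\<gamma>>0. \<forall>K. K \<noteq> (\<lambda>_. 0) \<longrightarrow> (\<forall>n::int. \<gamma> / real (height K) \<le> \<bar>phase K \<rho> - of_int n\<bar>)"
proof -
  define V where "V = measure lborel (double_cube :: (real ^ 'd ^ 'l) set)"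
  have V: "0 \<le> V" by (simp add: V_def)
  define E :: "nat \<Rightarrow> (real ^ 'd ^ 'l) set" where
    "E n = (\<Union>K\<in>-{\<lambda>_. 0}. near_resonance K (1 / (2 * real (height K * Suc n))))" for n
  \<comment> \<open>The tuples are enumerated through their codes; numbers that code no tuple contribute nothing.\<close>
  define g where "g i = (if i \<in> range (to_nat :: ('l \<Rightarrow> int ^ 'd) \<Rightarrow> nat)
      then 1 / real (height (from_nat i :: 'l \<Rightarrow> int ^ 'd)) else 0)" for i
  have g: "summable g" "\<And>i. 0 \<le> g i"
  proof -
    have "(\<lambda>i. 1 / real (height (from_nat i :: 'l \<Rightarrow> int ^ 'd))) summable_on range (to_nat :: ('l \<Rightarrow> int ^ 'd) \<Rightarrow> nat)"
      using summable_on_inverse_height[where 'l = 'l and 'd = 'd]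
      by (subst summable_on_reindex) (auto simp: o_def)
    then have "g summable_on UNIV"
      by (rule summable_on_cong_neutral[THEN iffD1, rotated -1]) (auto simp: g_def)
    then show "summable g" by (rule summable_on_imp_summable)
    show "0 \<le> g i" for i by (simp add: g_def)
  qed
  have E_meas: "E n \<in> sets borel" for n
    unfolding E_def by (intro sets.countable_UN'') auto
  have E_le: "emeasure lborel (E n) \<le> ennreal (V * suminf g / real (Suc n))" for n
  proof -
    define f where "f i = (if i \<in> range (to_nat :: ('l \<Rightarrow> int ^ 'd) \<Rightarrow> nat) \<and> (from_nat i :: 'l \<Rightarrow> int ^ 'd) \<noteq> (\<lambda>_. 0)
      then near_resonance (from_nat i :: 'l \<Rightarrow> int ^ 'd) (1 / (2 * real (height (from_nat i :: 'l \<Rightarrow> int ^ 'd) * Suc n))) else {})" for i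
    have "E n \<subseteq> (\<Union>i. f i)"
    proof
      fix \<rho> assume "\<rho> \<in> E n"
      then obtain K where "K \<noteq> (\<lambda>_. 0)" "\<rho> \<in> near_resonance K (1 / (2 * real (height K * Suc n)))"
        by (auto simp: E_def)
      then have "\<rho> \<in> f (to_nat K)" by (simp add: f_def)
      then show "\<rho> \<in> (\<Union>i. f i)" by blast
    qed
    then have "emeasure lborel (E n) \<le> emeasure lborel (\<Union>i. f i)"
      by (intro emeasure_mono) (auto simp: f_def)
    also have "\<dots> \<le> (\<Sum>i. emeasure lborel (f i))"
      by (intro emeasure_subadditive_countably) (auto simp: f_def)
    also have "\<dots> \<le> (\<Sum>i. ennreal (V / real (Suc n) * g i))"
    proof (intro suminf_le summableI)
      fix i
      show "emeasure lborel (f i) \<le> ennreal (V / real (Suc n) * g i)"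
      proof (cases "i \<in> range (to_nat :: ('l \<Rightarrow> int ^ 'd) \<Rightarrow> nat) \<and> (from_nat i :: 'l \<Rightarrow> int ^ 'd) \<noteq> (\<lambda>_. 0)")
        case True
        then show ?thesis
          using emeasure_near_resonance[of "from_nat i :: 'l \<Rightarrow> int ^ 'd" "height (from_nat i :: 'l \<Rightarrow> int ^ 'd) * Suc n"]
            height_pos[of "from_nat i :: 'l \<Rightarrow> int ^ 'd"]
          by (simp add: f_def g_def V_def algebra_simps)
      qed (auto simp: f_def)
    qed
    also have "\<dots> = ennreal (\<Sum>i. V / real (Suc n) * g i)"
      using g V by (intro suminf_ennreal2 summable_mult) auto
    also have "(\<Sum>i. V / real (Suc n) * g i) = V * suminf g / real (Suc n)"
      using g by (subst suminf_mult) auto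
    finally show ?thesis .
  qed
  define bad where "bad = (\<Inter>n. E n)"
  have bad_meas: "bad \<in> sets borel"
    unfolding bad_def using E_meas by auto
  have "emeasure lborel bad \<le> 0"
  proof (rule tendsto_lowerbound)
    have "((\<lambda>n. V * suminf g * (1 / real (Suc n))) \<longlonglongrightarrow> V * suminf g * 0)"
      by (intro tendsto_mult tendsto_const) (use LIMSEQ_inverse_real_of_nat in \<open>simp add: divide_inverse\<close>)
    then show "(\<lambda>n. ennreal (V * suminf g / real (Suc n))) \<longlonglongrightarrow> 0"
      by (intro tendsto_eq_intros(1)[of _ 0] tendsto_ennrealI[of _ 0, simplified]) simp
    show "\<forall>\<^sub>F n in sequentially. emeasure lborel bad \<le> ennreal (V * suminf g / real (Suc n))"
    proof (intro always_eventually allI)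
      fix n
      have "emeasure lborel bad \<le> emeasure lborel (E n)"
        using E_meas by (intro emeasure_mono) (auto simp: bad_def)
      then show "emeasure lborel bad \<le> ennreal (V * suminf g / real (Suc n))"
        using E_le[of n] by (rule order_trans)
    qed
  qed simp
  then have "bad \<in> null_sets lborel" using bad_meas by (auto intro: null_setsI)
  then have "AE \<rho> in lborel. \<rho> \<notin> bad" by (rule AE_not_in)
  then have "AE \<rho> in lebesgue. \<rho> \<notin> bad" by (rule AE_completion)
  moreover have "(torus_power :: (real ^ 'd ^ 'l) set) \<in> sets lebesgue"
    unfolding torus_power_cbox by simp
  ultimately show ?thesis
  proof (subst AE_restrict_space_iff)
    assume "AE \<rho> in lebesgue. \<rho> \<notin> bad"
    then show "AE \<rho> in lebesgue. \<rho> \<in> (torus_power :: (real ^ 'd ^ 'l) set) \<longrightarrow>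
      (\<exists>\<gamma>>0. \<forall>K. K \<noteq> (\<lambda>_. 0) \<longrightarrow> (\<forall>n::int. \<gamma> / real (height K) \<le> \<bar>phase K \<rho> - of_int n\<bar>))"
    proof (rule AE_mp, intro AE_I2 impI)
      fix \<rho> :: "real ^ 'd ^ 'l" assume "\<rho> \<notin> bad" and T: "\<rho> \<in> torus_power"
      then obtain n where n: "\<rho> \<notin> E n" by (auto simp: bad_def)
      show "\<exists>\<gamma>>0. \<forall>K. K \<noteq> (\<lambda>_. 0) \<longrightarrow> (\<forall>n::int. \<gamma> / real (height K) \<le> \<bar>phase K \<rho> - of_int n\<bar>)"
      proof (intro exI[of _ "1 / (2 * real (Suc n))"] conjI allI impI)
        fix K :: "'l \<Rightarrow> int ^ 'd" and m :: int assume "K \<noteq> (\<lambda>_. 0)"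
        then have "\<rho> \<notin> near_resonance K (1 / (2 * real (height K * Suc n)))" using n by (auto simp: E_def)
        then have "1 / (2 * real (height K * Suc n)) \<le> \<bar>phase K \<rho> - of_int m\<bar>"
          using T by (auto simp: near_resonance_def not_less)
        then show "1 / (2 * real (Suc n)) / real (height K) \<le> \<bar>phase K \<rho> - of_int m\<bar>"
          by (simp add: algebra_simps)
      qed simp
    qed
  qed simp
qed

section \<open>Averaging and integrating wave series\<close>

lemma has_sum_prod_fun:
  fixes f :: "'a::finite \<Rightarrow> 'b::countable \<Rightarrow> complex"
  assumes "\<And>x. (\<lambda>y. norm (f x y)) summable_on UNIV" "\<And>x. (f x has_sum S x) UNIV"
  shows "((\<lambda>g. \<Prod>x\<in>UNIV. f x (g x)) has_sum (\<Prod>x\<in>UNIV. S x)) UNIV"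
proof -
  have "(\<lambda>g. \<Prod>x\<in>UNIV. f x (g x)) summable_on UNIV"
    by (rule abs_summable_summable[OF norm_summable_prod_fun[OF assms(1)]])
  moreover have "infsum (\<lambda>g. \<Prod>x\<in>UNIV. f x (g x)) (PiE UNIV (\<lambda>_. UNIV)) = (\<Prod>x\<in>UNIV. infsum (f x) UNIV)"
    using assms(1) by (intro infsum_prod_PiE_abs) auto
  moreover have "infsum (f x) UNIV = S x" for x
    using assms(2) by (rule infsumI)
  ultimately show ?thesis by (simp add: PiE_UNIV_domain has_sum_iff)
qed

text \<open>The Weierstrass M-test for unordered sums.\<close>

lemma uniform_limit_has_sum:
  fixes f :: "'a \<Rightarrow> 'b \<Rightarrow> 'c::banach"
  assumes sum: "\<And>s. s \<in> X \<Longrightarrow> ((\<lambda>K. f K s) has_sum P s) UNIV"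
    and bound: "\<And>K s. s \<in> X \<Longrightarrow> norm (f K s) \<le> M K"
    and M: "M summable_on UNIV"
  shows "uniform_limit X (\<lambda>A s. \<Sum>K\<in>A. f K s) P (finite_subsets_at_top UNIV)"
proof (rule uniform_limitI)
  fix e :: real assume "0 < e"
  obtain m where m: "(M has_sum m) UNIV" using M by (auto simp: summable_on_def)
  then have "\<forall>\<^sub>F A in finite_subsets_at_top UNIV. dist (sum M A) m < e"
    unfolding has_sum_def using \<open>0 < e\<close> by (rule tendstoD)
  moreover have "\<forall>\<^sub>F A in finite_subsets_at_top (UNIV :: 'a set). finite A"
    by (rule eventually_finite_subsets_at_top_weakI) simp
  ultimately show "\<forall>\<^sub>F A in finite_subsets_at_top UNIV. \<forall>s\<in>X. dist (\<Sum>K\<in>A. f K s) (P s) < e"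
  proof eventually_elim
    case (elim A)
    show ?case
    proof
      fix s assume s: "s \<in> X"
      have "((\<lambda>K. f K s) has_sum (P s - (\<Sum>K\<in>A. f K s))) (UNIV - A)"
        using elim s by (intro has_sum_Diff sum has_sum_finite) auto
      moreover have "(M has_sum (m - sum M A)) (UNIV - A)"
        using elim by (intro has_sum_Diff m has_sum_finite) auto
      ultimately have "norm (P s - (\<Sum>K\<in>A. f K s)) \<le> m - sum M A"
        by (rule norm_infsum_le) (rule bound[OF s])
      then show "dist (\<Sum>K\<in>A. f K s) (P s) < e"
        using elim(1) by (simp add: dist_norm norm_minus_commute)
    qed
  qed
qed

lemma LINT_cbox_eq_integral:
  fixes f :: "'a::euclidean_space \<Rightarrow> complex"
  assumes "continuous_on (cbox a b) f"
  shows "(LINT x:cbox a b|lborel. f x) = integral (cbox a b) f"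
  using borel_integrable_compact[OF compact_cbox assms]
  by (intro set_borel_integral_eq_integral(2)) (simp add: set_integrable_def)

text \<open>Term-by-term integration; used both for the torus integral and for the continuous mean.\<close>

lemma has_sum_LINT_cbox:
  fixes f :: "'a \<Rightarrow> 'b::euclidean_space \<Rightarrow> complex"
  assumes sum: "\<And>s. s \<in> cbox a b \<Longrightarrow> ((\<lambda>K. f K s) has_sum P s) UNIV"
    and bound: "\<And>K s. s \<in> cbox a b \<Longrightarrow> norm (f K s) \<le> M K"
    and M: "M summable_on UNIV"
    and cont: "\<And>K. continuous_on (cbox a b) (f K)"
  shows "((\<lambda>K. LINT s:cbox a b|lborel. f K s) has_sum (LINT s:cbox a b|lborel. P s)) UNIV"
proof -
  have ul: "uniform_limit (cbox a b) (\<lambda>A s. \<Sum>K\<in>A. f K s) P (finite_subsets_at_top UNIV)"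
    by (rule uniform_limit_has_sum[OF sum bound M])
  have contA: "continuous_on (cbox a b) (\<lambda>s. \<Sum>K\<in>A. f K s)" for A
    by (intro continuous_on_sum cont)
  have contP: "continuous_on (cbox a b) P"
    by (rule uniform_limit_theorem[OF always_eventually[OF allI[OF contA]] ul]) simp
  obtain I J where I: "\<And>A. ((\<lambda>s. \<Sum>K\<in>A. f K s) has_integral I A) (cbox a b)"
    and J: "(P has_integral J) (cbox a b)" and lim: "(I \<longlongrightarrow> J) (finite_subsets_at_top UNIV)"
    using uniform_limit_integral_cbox[OF ul contA] by auto
  have "I A = (\<Sum>K\<in>A. LINT s:cbox a b|lborel. f K s)" if "finite A" for A
  proof -
    have "((\<lambda>s. \<Sum>K\<in>A. f K s) has_integral (\<Sum>K\<in>A. integral (cbox a b) (f K))) (cbox a b)"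
      using that by (intro has_integral_sum integrable_integral integrable_continuous cont)
    with I[of A] have "I A = (\<Sum>K\<in>A. integral (cbox a b) (f K))" by (rule has_integral_unique)
    then show ?thesis by (simp add: LINT_cbox_eq_integral[OF cont])
  qed
  then have "\<forall>\<^sub>F A in finite_subsets_at_top UNIV. I A = (\<Sum>K\<in>A. LINT s:cbox a b|lborel. f K s)"
    by (intro eventually_finite_subsets_at_top_weakI) simp
  from Lim_transform_eventually[OF lim this] show ?thesis
    using integral_unique[OF J] LINT_cbox_eq_integral[OF contP] by (simp add: has_sum_def)
qed

lemma has_sum_dmean:
  assumes "\<And>s. ((\<lambda>K. b K * wave (\<phi> K) s) has_sum P s) UNIV"
  shows "((\<lambda>K. b K * dmean N (wave (\<phi> K))) has_sum dmean N P) UNIV"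
proof -
  define W where "W = 1 / complex_of_real (\<Sum>n<N. weight (real n / real N))"
  have fin: "((\<lambda>K. \<Sum>n\<in>A. complex_of_real (weight (real n / real N)) * (b K * wave (\<phi> K) (real n)))
      has_sum (\<Sum>n\<in>A. complex_of_real (weight (real n / real N)) * P (real n))) UNIV" if "finite A" for A
    using that
  proof induction
    case (insert n A)
    then show ?case using has_sum_add[OF has_sum_cmult_right[OF assms] insert.IH] by simp
  qed simp
  have "((\<lambda>K. W * (\<Sum>n<N. complex_of_real (weight (real n / real N)) * (b K * wave (\<phi> K) (real n)))) has_sum dmean N P) UNIV"
    unfolding dmean_def W_def by (intro has_sum_cmult_right fin) simp
  also have "(\<lambda>K. W * (\<Sum>n<N. complex_of_real (weight (real n / real N)) * (b K * wave (\<phi> K) (real n))))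
     = (\<lambda>K. b K * dmean N (wave (\<phi> K)))"
    by (simp add: dmean_def W_def sum_distrib_left mult_ac)
  finally show ?thesis .
qed

lemma LINT_weight_eq_integral:
  assumes "continuous_on {0..T} f"
  shows "(LINT s:{0..T}|lborel. complex_of_real (weight (s / T)) * f s)
    = integral {0..T} (\<lambda>s. complex_of_real (weight (s / T)) * f s)"
  using LINT_cbox_eq_integral[of 0 T "\<lambda>s. complex_of_real (weight (s / T)) * f s"] assms
  by (simp add: continuous_intros continuous_weight)

lemma weight_le: "weight x \<le> 1 / bump_mass"
  unfolding weight_eq using bump_mass_pos by (intro divide_right_mono bump_le_one) simp

lemma has_sum_cmean:
  assumes sum: "\<And>s. ((\<lambda>K. b K * wave (\<phi> K) s) has_sum P s) UNIV"
    and b: "(\<lambda>K. norm (b K)) summable_on UNIV"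
  shows "((\<lambda>K. b K * cmean T (wave (\<phi> K))) has_sum
     (1 / complex_of_real T) * (LINT s:{0..T}|lborel. complex_of_real (weight (s / T)) * P s)) UNIV"
proof -
  have "((\<lambda>K. LINT s:cbox 0 T|lborel. complex_of_real (weight (s / T)) * (b K * wave (\<phi> K) s))
     has_sum (LINT s:cbox 0 T|lborel. complex_of_real (weight (s / T)) * P s)) UNIV"
  proof (rule has_sum_LINT_cbox[where M = "\<lambda>K. 1 / bump_mass * norm (b K)"])
    show "norm (complex_of_real (weight (s / T)) * (b K * wave (\<phi> K) s)) \<le> 1 / bump_mass * norm (b K)" for K s
      unfolding norm_mult norm_of_real norm_wave using weight_nonneg[of "s / T"]
        mult_right_mono[OF weight_le[of "s / T"] norm_ge_zero[of "b K"]] by simp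
    show "continuous_on (cbox 0 T) (\<lambda>s. complex_of_real (weight (s / T)) * (b K * wave (\<phi> K) s))" for K
      by (intro continuous_intros continuous_weight continuous_wave)
  qed (intro has_sum_cmult_right sum summable_on_cmult_right b)+
  then have "((\<lambda>K. (1 / complex_of_real T) * (LINT s:{0..T}|lborel. complex_of_real (weight (s / T)) * (b K * wave (\<phi> K) s)))
     has_sum (1 / complex_of_real T) * (LINT s:{0..T}|lborel. complex_of_real (weight (s / T)) * P s)) UNIV"
    unfolding box_real by (rule has_sum_cmult_right)
  moreover have "(1 / complex_of_real T) * (LINT s:{0..T}|lborel. complex_of_real (weight (s / T)) * (b K * wave (\<phi> K) s))
     = b K * cmean T (wave (\<phi> K))" for K
  proof -
    have "(LINT s:{0..T}|lborel. complex_of_real (weight (s / T)) * (b K * wave (\<phi> K) s))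
       = integral {0..T} (\<lambda>s. complex_of_real (weight (s / T)) * (b K * wave (\<phi> K) s))"
      by (intro LINT_weight_eq_integral continuous_on_mult continuous_on_const continuous_wave)
    also have "\<dots> = integral {0..T} (\<lambda>s. b K * (complex_of_real (weight (s / T)) * wave (\<phi> K) s))"
      by (simp only: mult.left_commute)
    also have "\<dots> = b K * integral {0..T} (\<lambda>s. complex_of_real (weight (s / T)) * wave (\<phi> K) s)"
      by (rule integral_mult_right)
    finally show ?thesis by (simp add: cmean_def)
  qed
  ultimately show ?thesis by simp
qed

definition freq_dot :: "int ^ 'd::finite \<Rightarrow> real ^ 'd \<Rightarrow> real" where
  "freq_dot k x = (\<Sum>i\<in>UNIV. of_int (k $ i) * x $ i)"

lemma character_of_real: "character k (\<chi> i. complex_of_real (x $ i)) = cis (2 * pi * freq_dot k x)"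
proof -
  have "(\<Sum>i\<in>UNIV. of_int (k $ i) * complex_of_real (x $ i)) = complex_of_real (freq_dot k x)"
    by (simp add: freq_dot_def)
  then show ?thesis by (simp add: character_def cis_conv_exp mult_ac)
qed

lemma cis_freq_dot_frac: "cis (2 * pi * freq_dot k (\<chi> i. frac (x $ i))) = cis (2 * pi * freq_dot k x)"
proof -
  have "freq_dot k x = freq_dot k (\<chi> i. frac (x $ i)) + real_of_int (\<Sum>i\<in>UNIV. k $ i * \<lfloor>x $ i\<rfloor>)"
    by (simp add: freq_dot_def frac_def algebra_simps sum.distrib sum_subtractf)
  then have "cis (2 * pi * freq_dot k x) = cis (2 * pi * freq_dot k (\<chi> i. frac (x $ i)))
      * cis (2 * pi * real_of_int (\<Sum>i\<in>UNIV. k $ i * \<lfloor>x $ i\<rfloor>))"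
    by (simp only: distrib_left cis_mult)
  also have "cis (2 * pi * real_of_int (\<Sum>i\<in>UNIV. k $ i * \<lfloor>x $ i\<rfloor>)) = 1"
    by (rule cis_multiple_2pi) (rule Ints_of_int)
  finally show ?thesis by simp
qed

lemma continuous_freq_dot: "continuous_on A (freq_dot k)"
  unfolding freq_dot_def by (intro continuous_intros)

lemma LINT_cis_unit_interval:
  "(LINT x:{0..1}|lborel. cis (2 * pi * of_int m * x)) = (if m = 0 then 1 else 0)"
proof -
  have "(LINT x:{0..1}|lborel. cis (2 * pi * of_int m * x)) = integral {0..1} (\<lambda>x. cis (2 * pi * of_int m * x))"
    using LINT_cbox_eq_integral[of 0 1 "\<lambda>x. cis (2 * pi * of_int m * x)"] by (simp add: continuous_intros)
  also have "\<dots> = (if m = 0 then 1 else 0)"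
  proof (cases "m = 0")
    case False
    define c where "c = 2 * complex_of_real pi * of_int m * \<i>"
    have c: "c \<noteq> 0" using False by (simp add: c_def)
    have cis: "cis (2 * pi * of_int m * x) = exp (c * of_real x)" for x
      by (simp add: cis_conv_exp c_def mult_ac)
    have "((\<lambda>x. exp (c * of_real x)) has_integral (exp (c * of_real 1) / c - exp (c * of_real 0) / c)) {0..1}"
    proof (rule fundamental_theorem_of_calculus)
      fix x :: real
      have "((\<lambda>z. exp (c * z) / c) has_field_derivative exp (c * of_real x)) (at (of_real x))"
        using c by (auto intro!: derivative_eq_intros)
      then show "((\<lambda>x. exp (c * of_real x) / c) has_vector_derivative exp (c * of_real x)) (at x within {0..1})"
        by (rule has_vector_derivative_real_field)
    qed simp
    moreover have "exp (c * of_real 1) = 1"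
      unfolding cis[symmetric] by (simp add: cis_multiple_2pi)
    ultimately show ?thesis using False by (simp add: cis integral_unique)
  qed simp
  finally show ?thesis .
qed

lemma torus_cbox: "(torus :: (real ^ 'd::finite) set) = cbox 0 1"
  by (auto simp: torus_def mem_box_cart)

text \<open>Orthogonality to the constants: in the coordinates given by the basis the character is a product of
  functions of one variable, so the integral over the cube splits into integrals over \<open>[0, 1]\<close>.\<close>

lemma LINT_character:
  "(LINT x:(torus :: (real ^ 'd::finite) set)|lborel. cis (2 * pi * freq_dot k x)) = (if k = 0 then 1 else 0)"
proof -
  define e :: "'d \<Rightarrow> real ^ 'd" where "e i = axis i 1" for i
  define \<kappa> where "\<kappa> b = freq_dot k b" for b
  have basis: "Basis = range e" by (auto simp: Basis_vec_def e_def)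
  have inj: "inj e" by (auto simp: inj_def e_def axis_eq_axis)
  have \<kappa>: "\<kappa> (e i) = of_int (k $ i)" for i
    by (simp add: \<kappa>_def freq_dot_def e_def axis_def if_distrib cong: if_cong)
  define g where "g b x = indicator {0..1} x *\<^sub>R cis (2 * pi * \<kappa> b * x)" for b x
  have comp: "(\<Sum>b\<in>Basis. f b *\<^sub>R b) $ i = f (e i)" for f i
  proof -
    have "(\<Sum>b\<in>Basis. f b *\<^sub>R b) $ i = (\<Sum>i'\<in>UNIV. f (e i') * e i' $ i)"
      unfolding basis using inj by (subst sum.reindex) auto
    also have "\<dots> = f (e i)" by (simp add: e_def axis_def if_distrib cong: if_cong)
    finally show ?thesis .
  qed
  have prod: "indicator torus (\<Sum>b\<in>Basis. f b *\<^sub>R b) *\<^sub>R cis (2 * pi * freq_dot k (\<Sum>b\<in>Basis. f b *\<^sub>R b))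
      = (\<Prod>b\<in>Basis. g b (f b))" for f
  proof -
    have "(\<Prod>b\<in>Basis. g b (f b)) = (\<Prod>i\<in>UNIV. g (e i) (f (e i)))"
      unfolding basis using inj by (subst prod.reindex) auto
    also have "\<dots> = (\<Prod>i\<in>UNIV. complex_of_real (indicator {0..1} (f (e i)))) * (\<Prod>i\<in>UNIV. cis (2 * pi * of_int (k $ i) * f (e i)))"
      by (simp add: g_def \<kappa> scaleR_conv_of_real prod.distrib)
    also have "(\<Prod>i\<in>UNIV. cis (2 * pi * of_int (k $ i) * f (e i))) = cis (2 * pi * freq_dot k (\<Sum>b\<in>Basis. f b *\<^sub>R b))"
      unfolding freq_dot_def comp by (simp add: cis_conv_exp exp_sum[symmetric] sum_distrib_left mult_ac)
    also have "(\<Prod>i\<in>UNIV. complex_of_real (indicator {0..1} (f (e i)))) = complex_of_real (indicator torus (\<Sum>b\<in>Basis. f b *\<^sub>R b))"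
    proof -
      have mem: "(\<Sum>b\<in>Basis. f b *\<^sub>R b) \<in> torus \<longleftrightarrow> (\<forall>i. f (e i) \<in> {0..1})"
        unfolding torus_def mem_Collect_eq comp by simp
      show ?thesis
      proof (cases "\<forall>i. f (e i) \<in> {0..1}")
        case True
        then show ?thesis using mem by (simp add: indicator_def)
      next
        case False
        then obtain i where "f (e i) \<notin> {0..1}" by blast
        then have "(\<Prod>i\<in>UNIV. complex_of_real (indicator {0..1} (f (e i)))) = 0"
          by (intro prod_zero) (auto intro!: exI[of _ i])
        then show ?thesis using mem False by (simp add: indicator_def)
      qed
    qed
    finally show ?thesis by (simp add: scaleR_conv_of_real)
  qed
  have [measurable]: "(\<lambda>x. cis (2 * pi * freq_dot k x)) \<in> borel_measurable borel"
    by (intro borel_measurable_continuous_onI continuous_intros continuous_freq_dot)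
  have [measurable]: "(torus :: (real ^ 'd) set) \<in> sets borel" by (simp add: torus_cbox)
  interpret product_sigma_finite "\<lambda>_ :: real ^ 'd. lborel :: real measure" by standard
  have g_int: "integrable lborel (g b)" for b
    unfolding g_def by (intro borel_integrable_compact continuous_intros) auto
  have "(LINT x:(torus :: (real ^ 'd) set)|lborel. cis (2 * pi * freq_dot k x))
      = (LINT f|(\<Pi>\<^sub>M b\<in>(Basis :: (real ^ 'd) set). lborel). indicator torus (\<Sum>b\<in>Basis. f b *\<^sub>R b) *\<^sub>R cis (2 * pi * freq_dot k (\<Sum>b\<in>Basis. f b *\<^sub>R b)))"
    unfolding set_lebesgue_integral_def by (subst lborel_eq, subst integral_distr) auto
  also have "\<dots> = (LINT f|(\<Pi>\<^sub>M b\<in>(Basis :: (real ^ 'd) set). lborel). (\<Prod>b\<in>Basis. g b (f b)))"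
    by (simp only: prod)
  also have "\<dots> = (\<Prod>b\<in>Basis. LINT x|lborel. g b x)"
    by (intro product_integral_prod g_int) simp
  also have "\<dots> = (\<Prod>i\<in>UNIV. LINT x|lborel. g (e i) x)"
    unfolding basis using inj by (subst prod.reindex) auto
  also have "\<dots> = (\<Prod>i\<in>UNIV. if k $ i = 0 then 1 else 0)"
    using LINT_cis_unit_interval unfolding g_def \<kappa> set_lebesgue_integral_def by simp
  also have "\<dots> = (if k = 0 then 1 else 0)"
    by (auto simp: vec_eq_iff prod_zero_iff)
  finally show ?thesis .
qed

section \<open>Fourier expansion along the orbit\<close>

definition total_norm :: "('l::finite \<Rightarrow> int ^ 'd::finite) \<Rightarrow> real" where
  "total_norm K = (\<Sum>j\<in>UNIV. real_of_int (norm1 (K j)))"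

lemma norm1_nonneg: "0 \<le> norm1 k"
  by (simp add: norm1_def sum_nonneg)

lemma total_norm_nonneg: "0 \<le> total_norm K"
  by (simp add: total_norm_def sum_nonneg norm1_nonneg)

lemma abs_coord_le_total_norm: "\<bar>real_of_int (K j $ i)\<bar> \<le> total_norm K"
proof -
  have "\<bar>K j $ i\<bar> \<le> norm1 (K j)"
    unfolding norm1_def by (rule member_le_sum) auto
  then have "\<bar>real_of_int (K j $ i)\<bar> \<le> real_of_int (norm1 (K j))" by linarith
  also have "\<dots> \<le> total_norm K"
    unfolding total_norm_def by (rule member_le_sum) (auto simp: norm1_nonneg)
  finally show ?thesis .
qed

lemma height_le:
  fixes K :: "'l::finite \<Rightarrow> int ^ 'd::finite"
  shows "real (height K) \<le> (1 + total_norm K) ^ (2 * (CARD('l) * CARD('d)))"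
proof -
  have "real (height K) = (\<Prod>j\<in>UNIV. \<Prod>i\<in>UNIV. (1 + \<bar>real_of_int (K j $ i)\<bar>)\<^sup>2)"
    unfolding height_def by simp
  also have "\<dots> \<le> (\<Prod>j\<in>(UNIV::'l set). \<Prod>i\<in>(UNIV::'d set). (1 + total_norm K)\<^sup>2)"
    by (intro prod_mono conjI prod_nonneg power_mono add_left_mono abs_coord_le_total_norm) auto
  also have "\<dots> = (1 + total_norm K) ^ (2 * (CARD('l) * CARD('d)))"
    by (simp add: power_mult[symmetric] mult_ac)
  finally show ?thesis .
qed

lemma summable_on_coefficients:
  fixes c :: "int ^ 'd::finite \<Rightarrow> complex"
  assumes "0 \<le> \<sigma>" "(\<lambda>k. norm (c k) * exp (2 * pi * \<sigma> * real_of_int (norm1 k))) summable_on UNIV"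
  shows "(\<lambda>k. norm (c k)) summable_on UNIV"
proof (rule summable_on_comparison_test[OF assms(2)])
  fix k :: "int ^ 'd"
  have "norm (c k) * 1 \<le> norm (c k) * exp (2 * pi * \<sigma> * real_of_int (norm1 k))"
    using assms(1) by (intro mult_left_mono) (auto simp: norm1_nonneg)
  then show "norm (c k) \<le> norm (c k) * exp (2 * pi * \<sigma> * real_of_int (norm1 k))" by simp
qed simp

lemma on_torus_has_sum:
  assumes "0 \<le> \<sigma>" "\<And>\<theta>. \<theta> \<in> strip \<sigma> \<Longrightarrow> ((\<lambda>k. c k * character k \<theta>) has_sum u \<theta>) UNIV" "x \<in> torus"
  shows "((\<lambda>k. c k * cis (2 * pi * freq_dot k x)) has_sum on_torus u x) UNIV"
proof -
  have "(\<chi> i. complex_of_real (x $ i)) \<in> strip \<sigma>"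
    using assms(1,3) by (simp add: strip_def torus_def)
  from assms(2)[OF this] show ?thesis
    unfolding character_of_real on_torus_def .
qed

lemma torus_integral_eq_coefficient:
  fixes c :: "int ^ 'd::finite \<Rightarrow> complex"
  assumes "0 \<le> \<sigma>" "(\<lambda>k. norm (c k) * exp (2 * pi * \<sigma> * real_of_int (norm1 k))) summable_on UNIV"
    and "\<And>\<theta>. \<theta> \<in> strip \<sigma> \<Longrightarrow> ((\<lambda>k. c k * character k \<theta>) has_sum u \<theta>) UNIV"
  shows "torus_integral (on_torus u) = c 0"
proof -
  have "((\<lambda>k. LINT x:cbox 0 1|lborel. c k * cis (2 * pi * freq_dot k x)) has_sum
      (LINT x:cbox 0 1|lborel. on_torus u x)) UNIV"
  proof (rule has_sum_LINT_cbox[where M = "\<lambda>k. norm (c k)"])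
    show "continuous_on (cbox 0 1) (\<lambda>x. c k * cis (2 * pi * freq_dot k x))" for k
      by (intro continuous_intros continuous_freq_dot)
  qed (use on_torus_has_sum[OF assms(1,3)] summable_on_coefficients[OF assms(1,2)] in
        \<open>auto simp: torus_cbox norm_mult\<close>)
  also have "(\<lambda>k. LINT x:cbox 0 1|lborel. c k * cis (2 * pi * freq_dot k x)) = (\<lambda>k. if k = 0 then c 0 else 0)"
    using LINT_character[where 'd = 'd] by (auto simp: torus_cbox)
  finally have "((\<lambda>k :: int ^ 'd. if k = 0 then c 0 else 0) has_sum torus_integral (on_torus u)) UNIV"
    unfolding torus_integral_def torus_cbox .
  moreover have "((\<lambda>k :: int ^ 'd. if k = 0 then c 0 else 0) has_sum c 0) UNIV"
    by (subst has_sum_cong_neutral[where T = "{0}" and g = "\<lambda>_. c 0"]) (auto intro!: has_sum_finiteI)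
  ultimately show ?thesis by (rule has_sum_unique)
qed

definition coeff_product :: "('l::finite \<Rightarrow> int ^ 'd::finite \<Rightarrow> complex) \<Rightarrow> ('l \<Rightarrow> int ^ 'd) \<Rightarrow> complex" where
  "coeff_product c K = (\<Prod>j\<in>UNIV. c j (K j))"

lemma summable_on_coeff_product:
  assumes "\<And>j. (\<lambda>k. norm (c j k) * exp (2 * pi * \<sigma> * real_of_int (norm1 k))) summable_on UNIV"
  shows "(\<lambda>K. norm (coeff_product c K) * exp (2 * pi * \<sigma> * total_norm K)) summable_on UNIV"
proof -
  have "(\<lambda>K. norm (\<Prod>j\<in>UNIV. norm (c j (K j)) * exp (2 * pi * \<sigma> * real_of_int (norm1 (K j))))) summable_on UNIV"
    using assms by (intro norm_summable_prod_fun[where f = "\<lambda>j k. norm (c j k) * exp (2 * pi * \<sigma> * real_of_int (norm1 k))"])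
      simp
  also have "(\<lambda>K. norm (\<Prod>j\<in>UNIV. norm (c j (K j)) * exp (2 * pi * \<sigma> * real_of_int (norm1 (K j)))))
     = (\<lambda>K. norm (coeff_product c K) * exp (2 * pi * \<sigma> * total_norm K))"
    by (simp add: coeff_product_def total_norm_def prod.distrib prod_norm[symmetric] abs_mult abs_prod
          exp_sum[symmetric] sum_distrib_left)
  finally show ?thesis .
qed

text \<open>Reducing the coordinates modulo 1 leaves every character unchanged, so the product of the series is
  a single series over tuples, in which the time only enters through the wave of frequency \<open>phase K \<rho>\<close>.\<close>

lemma rotated_product_has_sum:
  fixes c :: "'l::finite \<Rightarrow> int ^ 'd::finite \<Rightarrow> complex"
  assumes "0 \<le> \<sigma>" "\<And>j. (\<lambda>k. norm (c j k) * exp (2 * pi * \<sigma> * real_of_int (norm1 k))) summable_on UNIV"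
    and "\<And>j \<theta>. \<theta> \<in> strip \<sigma> \<Longrightarrow> ((\<lambda>k. c j k * character k \<theta>) has_sum F j \<theta>) UNIV"
  shows "((\<lambda>K. coeff_product c K * cis (2 * pi * (\<Sum>j\<in>UNIV. freq_dot (K j) \<theta>)) * wave (phase K \<rho>) s) has_sum
     (\<Prod>j\<in>UNIV. on_torus (F j) (rotation (\<rho> $ j) s \<theta>))) UNIV"
proof -
  have one: "((\<lambda>k. c j k * cis (2 * pi * freq_dot k (\<theta> + s *\<^sub>R \<rho> $ j))) has_sum on_torus (F j) (rotation (\<rho> $ j) s \<theta>)) UNIV" for j
  proof -
    have rot: "rotation (\<rho> $ j) s \<theta> = (\<chi> i. frac ((\<theta> + s *\<^sub>R \<rho> $ j) $ i))"
      by (simp add: rotation_def)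
    have "rotation (\<rho> $ j) s \<theta> \<in> torus"
      using less_imp_le[OF frac_lt_1[where 'a = real]] by (simp add: torus_def rotation_def)
    from on_torus_has_sum[OF assms(1,3) this] show ?thesis
      unfolding rot cis_freq_dot_frac .
  qed
  have "((\<lambda>K. \<Prod>j\<in>UNIV. c j (K j) * cis (2 * pi * freq_dot (K j) (\<theta> + s *\<^sub>R \<rho> $ j))) has_sum
     (\<Prod>j\<in>UNIV. on_torus (F j) (rotation (\<rho> $ j) s \<theta>))) UNIV"
  proof (rule has_sum_prod_fun[where f = "\<lambda>j k. c j k * cis (2 * pi * freq_dot k (\<theta> + s *\<^sub>R \<rho> $ j))"])
    show "(\<lambda>k. norm (c j k * cis (2 * pi * freq_dot k (\<theta> + s *\<^sub>R \<rho> $ j)))) summable_on UNIV" for j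
      using summable_on_coefficients[OF assms(1,2)] by (simp add: norm_mult)
  qed (rule one)
  also have "(\<lambda>K. \<Prod>j\<in>UNIV. c j (K j) * cis (2 * pi * freq_dot (K j) (\<theta> + s *\<^sub>R \<rho> $ j)))
     = (\<lambda>K. coeff_product c K * cis (2 * pi * (\<Sum>j\<in>UNIV. freq_dot (K j) \<theta>)) * wave (phase K \<rho>) s)"
  proof
    fix K :: "'l \<Rightarrow> int ^ 'd"
    have cis_sum: "(\<Prod>j\<in>UNIV. cis (2 * pi * g j)) = cis (2 * pi * (\<Sum>j\<in>UNIV. g j))" for g :: "'l \<Rightarrow> real"
      by (simp add: cis_conv_exp exp_sum[symmetric] sum_distrib_left)
    have "freq_dot (K j) (\<theta> + s *\<^sub>R \<rho> $ j) = freq_dot (K j) \<theta> + s * freq_dot (K j) (\<rho> $ j)" for j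
      by (simp add: freq_dot_def algebra_simps sum.distrib sum_distrib_left)
    then have "(\<Sum>j\<in>UNIV. freq_dot (K j) (\<theta> + s *\<^sub>R \<rho> $ j)) = (\<Sum>j\<in>UNIV. freq_dot (K j) \<theta>) + phase K \<rho> * s"
      by (simp add: sum.distrib phase_def freq_dot_def sum_distrib_left[symmetric] mult.commute)
    then have "(\<Prod>j\<in>UNIV. cis (2 * pi * freq_dot (K j) (\<theta> + s *\<^sub>R \<rho> $ j)))
        = cis (2 * pi * (\<Sum>j\<in>UNIV. freq_dot (K j) \<theta>)) * wave (phase K \<rho>) s"
      unfolding cis_sum wave_def by (simp add: cis_mult distrib_left mult.assoc)
    then show "(\<Prod>j\<in>UNIV. c j (K j) * cis (2 * pi * freq_dot (K j) (\<theta> + s *\<^sub>R \<rho> $ j)))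
      = coeff_product c K * cis (2 * pi * (\<Sum>j\<in>UNIV. freq_dot (K j) \<theta>)) * wave (phase K \<rho>) s"
      by (simp add: coeff_product_def prod.distrib mult.assoc)
  qed
  finally show ?thesis .
qed

section \<open>The error estimate\<close>

text \<open>The damping factor \<open>exp (- 2 \<pi> \<sigma> \<parallel>K\<parallel>)\<close> is split off the coefficients and given to the means. A
  bound on the damped means that is uniform in \<open>K\<close> then suffices, and the analytic norm pays for the
  summation.\<close>

lemma averaged_series_error:
  fixes b m :: "('l::finite \<Rightarrow> int ^ 'd::finite) \<Rightarrow> complex"
  assumes V: "((\<lambda>K. b K * m K) has_sum V) UNIV"
    and S: "((\<lambda>K. norm (b K) * exp (2 * pi * \<sigma> * total_norm K)) has_sum S) UNIV"
    and m0: "m (\<lambda>_. 0) = 1"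
    and \<eta>: "\<And>K. K \<noteq> (\<lambda>_. 0) \<Longrightarrow> exp (- (2 * pi * \<sigma> * total_norm K)) * norm (m K) \<le> \<eta>" "0 \<le> \<eta>"
  shows "norm (V - b (\<lambda>_. 0)) \<le> S * \<eta>"
proof (rule norm_infsum_le)
  have "((\<lambda>K. b K * m K) has_sum (b (\<lambda>_. 0))) {\<lambda>_. 0}"
    by (rule has_sum_finiteI) (auto simp: m0)
  then have "((\<lambda>K. b K * m K) has_sum (V - b (\<lambda>_. 0))) (UNIV - {\<lambda>_. 0})"
    by (intro has_sum_Diff V) auto
  then show "((\<lambda>K. if K = (\<lambda>_. 0) then 0 else b K * m K) has_sum (V - b (\<lambda>_. 0))) UNIV"
    by (rule has_sum_cong_neutral[THEN iffD1, rotated -1]) auto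
  show "((\<lambda>K. norm (b K) * exp (2 * pi * \<sigma> * total_norm K) * \<eta>) has_sum S * \<eta>) UNIV"
    by (rule has_sum_cmult_left[OF S])
  fix K :: "'l \<Rightarrow> int ^ 'd"
  show "norm (if K = (\<lambda>_. 0) then 0 else b K * m K) \<le> norm (b K) * exp (2 * pi * \<sigma> * total_norm K) * \<eta>"
  proof (cases "K = (\<lambda>_. 0)")
    case False
    have "norm (b K * m K) = norm (b K) * exp (2 * pi * \<sigma> * total_norm K) * (exp (- (2 * pi * \<sigma> * total_norm K)) * norm (m K))"
      by (simp add: norm_mult exp_minus)
    also have "\<dots> \<le> norm (b K) * exp (2 * pi * \<sigma> * total_norm K) * \<eta>"
      by (rule mult_left_mono[OF \<eta>(1)[OF False]]) simp
    finally show ?thesis using False by simp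
  qed (use \<eta> in simp)
qed

text \<open>The bound for the mean of one wave at contour height \<open>h = x powr (1/3)\<close>; the exponents then are
  \<open>x powr (1/3) / 4\<close> and \<open>2 \<pi> \<kappa> x powr (1/3)\<close>.\<close>

definition wave_rate :: "real \<Rightarrow> real \<Rightarrow> real \<Rightarrow> real" where
  "wave_rate C \<kappa> x = C * (x powr (1/3) * exp (- (x / (4 * (x powr (1/3))\<^sup>2))) + x * exp (- (2 * pi * \<kappa> * x powr (1/3))))"

text \<open>The cutoff \<open>1 + \<parallel>K\<parallel> \<le> x powr (1 / (12 D))\<close>, where \<open>D\<close> is the number of coordinates, is where the
  height, of degree \<open>2 D\<close>, reaches \<open>x powr (1/6)\<close>: below it the wave decays, and above it the damping is
  at work.\<close>

lemma small_divisor_bound: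
  fixes K :: "'l::finite \<Rightarrow> int ^ 'd::finite" and m :: "real \<Rightarrow> complex"
  assumes x: "1 \<le> x" and C: "0 \<le> C" and \<sigma>: "0 \<le> \<sigma>" and \<gamma>: "0 < \<gamma>"
    and K: "\<And>n::int. \<gamma> / real (height K) \<le> \<bar>phase K \<rho> - of_int n\<bar>"
    and decay: "\<And>a \<kappa>. 0 < \<kappa> \<Longrightarrow> (\<And>n::int. \<kappa> \<le> \<bar>a - of_int n\<bar>) \<Longrightarrow> norm (m a) \<le> wave_rate C \<kappa> x"
    and le1: "\<And>a. norm (m a) \<le> 1"
  shows "exp (- (2 * pi * \<sigma> * total_norm K)) * norm (m (phase K \<rho>))
    \<le> wave_rate C (\<gamma> * x powr (- 1/6)) x
      + exp (- (2 * pi * \<sigma> * (x powr (1 / (12 * real (CARD('l) * CARD('d)))) - 1)))"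
proof -
  define D where "D = CARD('l) * CARD('d)"
  have D: "0 < D" by (simp add: D_def)
  let ?R = "x powr (1 / (12 * real D)) - 1"
  have t: "0 \<le> total_norm K" by (rule total_norm_nonneg)
  have nn: "0 \<le> wave_rate C (\<gamma> * x powr (- 1/6)) x" using x C by (simp add: wave_rate_def)
  have "exp (- (2 * pi * \<sigma> * total_norm K)) * norm (m (phase K \<rho>))
    \<le> wave_rate C (\<gamma> * x powr (- 1/6)) x + exp (- (2 * pi * \<sigma> * ?R))"
  proof (cases "total_norm K \<le> ?R")
    case True
    have "real (height K) \<le> (1 + total_norm K) ^ (2 * D)"
      using height_le[of K] by (simp add: D_def)
    also have "\<dots> \<le> (x powr (1 / (12 * real D))) ^ (2 * D)"
      using True t by (intro power_mono) auto
    also have "\<dots> = x powr (1/6)"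
      using x D by (simp add: powr_realpow[symmetric] powr_powr)
    finally have h: "real (height K) \<le> x powr (1/6)" .
    have "\<gamma> * x powr (- 1/6) = \<gamma> / x powr (1/6)" by (simp add: powr_minus_divide)
    also have "\<dots> \<le> \<gamma> / real (height K)"
      using h \<gamma> x height_pos[of K] by (intro divide_left_mono) auto
    finally have "norm (m (phase K \<rho>)) \<le> wave_rate C (\<gamma> * x powr (- 1/6)) x"
      using \<gamma> x K by (intro decay) (auto intro: order_trans)
    then have "exp (- (2 * pi * \<sigma> * total_norm K)) * norm (m (phase K \<rho>)) \<le> 1 * wave_rate C (\<gamma> * x powr (- 1/6)) x"
      using \<sigma> t by (intro mult_mono) auto
    then show ?thesis by (simp add: add_increasing2)
  next
    case False
    then have "2 * pi * \<sigma> * ?R \<le> 2 * pi * \<sigma> * total_norm K"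
      using \<sigma> by (intro mult_left_mono) auto
    then have "exp (- (2 * pi * \<sigma> * total_norm K)) * norm (m (phase K \<rho>)) \<le> exp (- (2 * pi * \<sigma> * ?R)) * 1"
      by (intro mult_mono le1) auto
    then show ?thesis using nn by simp
  qed
  then show ?thesis by (simp only: D_def)
qed

lemma eventually_wave_rate_le:
  assumes "0 < C" "0 < \<gamma>"
  shows "\<forall>\<^sub>F x in at_top. wave_rate C (\<gamma> * x powr (- 1/6)) x \<le> exp (- (x powr (1/24))) / 2"
  unfolding wave_rate_def using assms by real_asymp

lemma eventually_tail_le:
  assumes "0 < \<sigma>" shows "\<forall>\<^sub>F y in at_top. exp (- (2 * pi * \<sigma> * (y\<^sup>2 - 1))) \<le> exp (- y) / (2 :: real)"
  using assms by real_asymp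

text \<open>The wave terms decay like \<open>exp (- c x powr (1/6))\<close> and the tail like \<open>exp (- c x powr \<delta>)\<close>.
  Halving the exponent \<open>\<delta>\<close> absorbs the constants and polynomial factors.\<close>

lemma eventually_total_rate_le:
  assumes "0 < C" "0 < \<gamma>" "0 < \<sigma>" "0 < \<delta>" "\<delta> \<le> 1/12"
  shows "\<forall>\<^sub>F x in at_top. wave_rate C (\<gamma> * x powr (- 1/6)) x + exp (- (2 * pi * \<sigma> * (x powr \<delta> - 1)))
     \<le> exp (- (x powr (\<delta> / 2)))"
proof -
  have "filterlim (\<lambda>x::real. x powr (\<delta> / 2)) at_top at_top"
    using assms(4) by real_asymp
  from eventually_compose_filterlim[OF eventually_tail_le[OF assms(3)] this]
  have "\<forall>\<^sub>F x in at_top. exp (- (2 * pi * \<sigma> * ((x powr (\<delta> / 2))\<^sup>2 - 1))) \<le> exp (- (x powr (\<delta> / 2))) / 2" .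
  then show ?thesis
    using eventually_wave_rate_le[OF assms(1,2)] eventually_ge_at_top[of 1]
  proof eventually_elim
    case (elim x)
    have sq: "(x powr (\<delta> / 2))\<^sup>2 = x powr \<delta>"
      using elim(3) by (simp add: power2_eq_square powr_add[symmetric])
    have "x powr (\<delta> / 2) \<le> x powr (1/24)"
      using elim(3) assms(5) by (intro powr_mono) auto
    then have "exp (- (x powr (1/24))) / 2 \<le> exp (- (x powr (\<delta> / 2))) / 2" by simp
    with elim(2) have "wave_rate C (\<gamma> * x powr (- 1/6)) x \<le> exp (- (x powr (\<delta> / 2))) / 2"
      by (rule order_trans)
    from add_mono[OF this elim(1)[unfolded sq]] show ?case by simp
  qed
qed

lemma cube_root_ge_1: "1 \<le> x \<Longrightarrow> 1 \<le> x powr (1/3)" for x :: real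
  by (simp add: ge_one_powr_ge_zero)

lemma wave_zero: "wave 0 = (\<lambda>_. 1)"
  by (simp add: wave_def fun_eq_iff)

theorem theorem4p3:
  fixes \<sigma> :: real
    and F :: "'l::finite \<Rightarrow> complex ^ 'd::finite \<Rightarrow> complex"
  assumes "\<sigma> > 0"
    and "\<And>j. F j \<in> analytic_space \<sigma>"
  shows "AE \<rho> in lebesgue_on (torus_power :: (real ^ 'd ^ 'l) set).
    \<exists>\<zeta>>0.
      (\<exists>C. \<forall>\<^sub>F N in sequentially. \<forall>\<theta>\<in>torus.
         norm (DMW (\<lambda>j. on_torus (F j)) \<rho> N \<theta> - (\<Prod>j\<in>UNIV. torus_integral (on_torus (F j))))
           \<le> C * exp (- (real N powr \<zeta>))) \<and>
      (\<exists>C. \<forall>\<^sub>F T in at_top. \<forall>\<theta>\<in>torus.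
         norm (CMW (\<lambda>j. on_torus (F j)) \<rho> T \<theta> - (\<Prod>j\<in>UNIV. torus_integral (on_torus (F j))))
           \<le> C * exp (- (T powr \<zeta>)))"
proof -
  have "\<forall>j. \<exists>c. (\<lambda>k. norm (c k) * exp (2 * pi * \<sigma> * real_of_int (norm1 k))) summable_on UNIV \<and>
           (\<forall>\<theta>\<in>strip \<sigma>. ((\<lambda>k. c k * character k \<theta>) has_sum F j \<theta>) UNIV)"
  proof
    fix j
    from assms(2)[of j] show "\<exists>c. (\<lambda>k. norm (c k) * exp (2 * pi * \<sigma> * real_of_int (norm1 k))) summable_on UNIV \<and>
           (\<forall>\<theta>\<in>strip \<sigma>. ((\<lambda>k. c k * character k \<theta>) has_sum F j \<theta>) UNIV)"
      unfolding analytic_space_def by (rule CollectD)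
  qed
  from choice[OF this] obtain c where c: "\<And>j. (\<lambda>k. norm (c j k) * exp (2 * pi * \<sigma> * real_of_int (norm1 k))) summable_on UNIV"
    and F: "\<And>j \<theta>. \<theta> \<in> strip \<sigma> \<Longrightarrow> ((\<lambda>k. c j k * character k \<theta>) has_sum F j \<theta>) UNIV"
    by blast
  have \<sigma>0: "0 \<le> \<sigma>" using assms(1) by simp
  define D where "D = CARD('l) * CARD('d)"
  have D: "1 \<le> D" by (simp add: D_def Suc_le_eq)
  define \<delta> where "\<delta> = 1 / (12 * real D)"
  have \<delta>: "0 < \<delta>" "\<delta> \<le> 1/12" using D by (auto simp: \<delta>_def field_simps)
  define S where "S = infsum (\<lambda>K. norm (coeff_product c K) * exp (2 * pi * \<sigma> * total_norm K)) UNIV"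
  have S: "((\<lambda>K. norm (coeff_product c K) * exp (2 * pi * \<sigma> * total_norm K)) has_sum S) UNIV"
    unfolding S_def by (rule has_sum_infsum[OF summable_on_coeff_product[OF c]])
  have target: "(\<Prod>j\<in>UNIV. torus_integral (on_torus (F j))) = coeff_product c (\<lambda>_. 0)"
    unfolding coeff_product_def by (intro prod.cong refl torus_integral_eq_coefficient[OF \<sigma>0 c F])
  define b where "b \<theta> K = coeff_product c K * cis (2 * pi * (\<Sum>j\<in>UNIV. freq_dot (K j) \<theta>))" for \<theta> K
  have b0: "b \<theta> (\<lambda>_. 0) = coeff_product c (\<lambda>_. 0)" for \<theta>
    by (simp add: b_def freq_dot_def)
  have norm_b: "norm (b \<theta> K) = norm (coeff_product c K)" for \<theta> K
    by (simp add: b_def norm_mult)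
  have phase0: "phase (\<lambda>_. 0) \<rho> = 0" for \<rho> :: "real ^ 'd ^ 'l"
    by (simp add: phase_def)
  \<comment> \<open>Both means satisfy the hypotheses of this estimate, with different constants \<open>C\<close>.\<close>
  have error: "norm (V - coeff_product c (\<lambda>_. 0)) \<le> S * exp (- (x powr (\<delta> / 2)))"
    if V: "((\<lambda>K. b \<theta> K * m (phase K \<rho>)) has_sum V) UNIV" and x: "1 \<le> x" and C: "0 < C" and \<gamma>: "0 < \<gamma>"
      and dio: "\<And>K n. K \<noteq> (\<lambda>_. 0) \<Longrightarrow> \<gamma> / real (height K) \<le> \<bar>phase K \<rho> - of_int n\<bar>"
      and decay: "\<And>a \<kappa>. 0 < \<kappa> \<Longrightarrow> (\<And>n::int. \<kappa> \<le> \<bar>a - of_int n\<bar>) \<Longrightarrow> norm (m a) \<le> wave_rate C \<kappa> x"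
      and le1: "\<And>a. norm (m a) \<le> 1" and m0: "m 0 = 1"
      and rate: "wave_rate C (\<gamma> * x powr (- 1/6)) x + exp (- (2 * pi * \<sigma> * (x powr \<delta> - 1))) \<le> exp (- (x powr (\<delta> / 2)))"
    for V x C \<gamma> \<theta> m and \<rho> :: "real ^ 'd ^ 'l"
  proof -
    have "norm (V - b \<theta> (\<lambda>_. 0)) \<le> S * exp (- (x powr (\<delta> / 2)))"
    proof (rule averaged_series_error[OF V])
      show "((\<lambda>K. norm (b \<theta> K) * exp (2 * pi * \<sigma> * total_norm K)) has_sum S) UNIV"
        unfolding norm_b by (rule S)
      fix K :: "'l \<Rightarrow> int ^ 'd" assume "K \<noteq> (\<lambda>_. 0)"
      from small_divisor_bound[OF x less_imp_le[OF C] \<sigma>0 \<gamma> dio[OF this] decay le1] rate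
      show "exp (- (2 * pi * \<sigma> * total_norm K)) * norm (m (phase K \<rho>)) \<le> exp (- (x powr (\<delta> / 2)))"
        unfolding \<delta>_def D_def by (rule order_trans)
    qed (simp_all add: phase0 m0)
    then show ?thesis by (simp only: b0)
  qed
  define P where "P \<rho> \<theta> s = (\<Prod>j\<in>UNIV. on_torus (F j) (rotation (\<rho> $ j) s \<theta>))" for \<rho> \<theta> s
  have P: "((\<lambda>K. b \<theta> K * wave (phase K \<rho>) s) has_sum P \<rho> \<theta> s) UNIV" for \<rho> \<theta> s
    unfolding P_def b_def by (rule rotated_product_has_sum[OF \<sigma>0 c F])
  have sum_b: "(\<lambda>K. norm (b \<theta> K)) summable_on UNIV" for \<theta>
  proof (rule summable_on_comparison_test)
    show "(\<lambda>K. norm (coeff_product c K) * exp (2 * pi * \<sigma> * total_norm K)) summable_on UNIV"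
      by (rule summable_on_coeff_product[OF c])
    fix K :: "'l \<Rightarrow> int ^ 'd"
    have "norm (coeff_product c K) * 1 \<le> norm (coeff_product c K) * exp (2 * pi * \<sigma> * total_norm K)"
      using \<sigma>0 total_norm_nonneg[of K] by (intro mult_left_mono) auto
    then show "norm (b \<theta> K) \<le> norm (coeff_product c K) * exp (2 * pi * \<sigma> * total_norm K)"
      by (simp add: norm_b)
  qed simp
  have DMW_sum: "((\<lambda>K. b \<theta> K * dmean N (wave (phase K \<rho>))) has_sum DMW (\<lambda>j. on_torus (F j)) \<rho> N \<theta>) UNIV" for N \<rho> \<theta>
    using has_sum_dmean[OF P] unfolding DMW_def dmean_def P_def .
  have CMW_sum: "((\<lambda>K. b \<theta> K * cmean T (wave (phase K \<rho>))) has_sum CMW (\<lambda>j. on_torus (F j)) \<rho> T \<theta>) UNIV" for T \<rho> \<theta>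
    using has_sum_cmean[OF P sum_b] unfolding CMW_def P_def .
  show ?thesis
    using AE_diophantine[where 'l = 'l and 'd = 'd]
  proof (rule AE_mp, intro AE_I2 impI)
    fix \<rho> :: "real ^ 'd ^ 'l"
    assume "\<exists>\<gamma>>0. \<forall>K. K \<noteq> (\<lambda>_. 0) \<longrightarrow> (\<forall>n::int. \<gamma> / real (height K) \<le> \<bar>phase K \<rho> - of_int n\<bar>)"
    then obtain \<gamma> where \<gamma>: "0 < \<gamma>"
      and dio: "\<And>K n. K \<noteq> (\<lambda>_. 0) \<Longrightarrow> \<gamma> / real (height K) \<le> \<bar>phase K \<rho> - of_int n\<bar>" by blast
    have disc: "\<forall>\<^sub>F N in sequentially. \<forall>\<theta>\<in>torus.
         norm (DMW (\<lambda>j. on_torus (F j)) \<rho> N \<theta> - (\<Prod>j\<in>UNIV. torus_integral (on_torus (F j))))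
           \<le> S * exp (- (real N powr (\<delta> / 2)))"
    proof -
      have C: "0 < 4 * exp (9/2 :: real)" by simp
      show ?thesis
        using eventually_compose_filterlim[OF eventually_total_rate_le[OF C \<gamma> assms(1) \<delta>] filterlim_real_sequentially]
          eventually_ge_at_top[of 2]
      proof eventually_elim
        case (elim N)
        show ?case unfolding target
        proof
          fix \<theta> :: "real ^ 'd"
          have N: "1 \<le> real N" using elim(2) by simp
          show "norm (DMW (\<lambda>j. on_torus (F j)) \<rho> N \<theta> - coeff_product c (\<lambda>_. 0)) \<le> S * exp (- (real N powr (\<delta> / 2)))"
          proof (rule error[OF DMW_sum N C \<gamma> dio _ _ _ elim(1)])
            show "norm (dmean N (wave a)) \<le> wave_rate (4 * exp (9/2)) \<kappa> (real N)"
              if "0 < \<kappa>" "\<And>n::int. \<kappa> \<le> \<bar>a - of_int n\<bar>" for a \<kappa>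
              unfolding wave_rate_def by (rule dmean_wave_decay[OF elim(2) cube_root_ge_1[OF N] that])
            show "norm (dmean N (wave a)) \<le> 1" for a
              by (rule norm_dmean_le) (simp add: norm_wave)
            show "dmean N (wave 0) = 1" using dmean_one[OF elim(2)] by (simp add: wave_zero)
          qed
        qed
      qed
    qed
    have cont: "\<forall>\<^sub>F T in at_top. \<forall>\<theta>\<in>torus.
         norm (CMW (\<lambda>j. on_torus (F j)) \<rho> T \<theta> - (\<Prod>j\<in>UNIV. torus_integral (on_torus (F j))))
           \<le> S * exp (- (T powr (\<delta> / 2)))"
    proof -
      have C: "0 < 3 / bump_mass" using bump_mass_pos by simp
      show ?thesis
        using eventually_total_rate_le[OF C \<gamma> assms(1) \<delta>] eventually_gt_at_top[of 1]
      proof eventually_elim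
        case (elim T)
        show ?case unfolding target
        proof
          fix \<theta> :: "real ^ 'd"
          have T: "1 \<le> T" using elim(2) by simp
          show "norm (CMW (\<lambda>j. on_torus (F j)) \<rho> T \<theta> - coeff_product c (\<lambda>_. 0)) \<le> S * exp (- (T powr (\<delta> / 2)))"
          proof (rule error[OF CMW_sum T C \<gamma> dio _ _ _ elim(1)])
            show "norm (cmean T (wave a)) \<le> wave_rate (3 / bump_mass) \<kappa> T"
              if "0 < \<kappa>" "\<And>n::int. \<kappa> \<le> \<bar>a - of_int n\<bar>" for a \<kappa>
              unfolding wave_rate_def
              by (rule cmean_wave_decay[OF elim(2) cube_root_ge_1[OF T] that(1)]) (use that(2)[of 0] in simp)
            show "norm (cmean T (wave a)) \<le> 1" for a
              by (rule norm_cmean_le) (use T in \<open>auto simp: norm_wave continuous_wave\<close>)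
            show "cmean T (wave 0) = 1" using cmean_one[of T] T by (simp add: wave_zero)
          qed
        qed
      qed
    qed
    show "\<exists>\<zeta>>0.
      (\<exists>C. \<forall>\<^sub>F N in sequentially. \<forall>\<theta>\<in>torus.
         norm (DMW (\<lambda>j. on_torus (F j)) \<rho> N \<theta> - (\<Prod>j\<in>UNIV. torus_integral (on_torus (F j))))
           \<le> C * exp (- (real N powr \<zeta>))) \<and>
      (\<exists>C. \<forall>\<^sub>F T in at_top. \<forall>\<theta>\<in>torus.
         norm (CMW (\<lambda>j. on_torus (F j)) \<rho> T \<theta> - (\<Prod>j\<in>UNIV. torus_integral (on_torus (F j))))
           \<le> C * exp (- (T powr \<zeta>)))"
      using disc cont \<delta>(1) by (intro exI[of _ "\<delta> / 2"]) auto
  qed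
qed

end
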